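(* Let $\mathcal J\in C^1(X,\mathbb R)$ be an invariant functional. (1) If for some positive integer $j$ one has $c_j>-\infty$ and $\mathcal J$ satisfies the $(wPS)_{c_j}$-condition, then $K_{c_j}\neq\emptyset$. (2) Moreover, if for some positive integers $j<k$ one has $c_j=c_k=c>-\infty$, $\mathcal J$ satisfies the $(wPS)_c$-condition, and $K_c\cap\operatorname{Fix}(S^1)=\emptyset$, then there exists a sequence $(q_n)\subset X$ such that $\bigcup_n\mathcal O(q_n)\subset K_c$ and $\mathcal O(q_m)\cap\mathcal O(q_n)=\emptyset$ for all positive integers $m\neq n$; that is, there exists a sequence of distinct critical orbits of $\mathcal J$ at the level $c$.
   Context: $(X,\langle\cdot,\cdot\rangle)$ is a real Hilbert space and $(Y,\|\cdot\|_Y)$ a real Banach space with $X\subset Y$ such that the canonical injection $X\to Y$ is a compact operator. $S^1$ is identified with $\mathbb R/2\pi\mathbb Z$. An isometric representation of $S^1$ over a Banach space $\mathcal X$ is a map $\theta\mapsto L(\theta)$ into the bounded linear operators on $\mathcal X$ with $L(0)=\mathrm{id}$, $L(\theta_1+\theta_2)=L(\theta_1)L(\theta_2)$, $(\theta,x)\mapsto L(\theta)x$ continuous, and each $L(\theta)$ norm-preserving. Let $L$ be an isometric representation of $S^1$ over $Y$ such that $L(\theta)X=X$ for all $\theta$ and the restrictions $L(\theta)|_X$ form an isometric representation of $S^1$ over $X$. Let $\operatorname{Fix}(S^1)=\{y\in Y: L(\theta)y=y\ \forall\theta\in S^1\}$ and assume $\operatorname{Fix}(S^1)\subset X$. The orbit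 of $y$ is $\mathcal O(y)=\{L(\theta)y:\theta\in S^1\}$. A set $A$ is invariant if $L(\theta)A=A$ for all $\theta$; a functional $\mathcal J$ on $X$ is invariant if $\mathcal J\circ L(\theta)=\mathcal J$ for all $\theta$. $S^1$-index: for a closed invariant $A\subset X$, $\operatorname{ind}(A)$ is the smallest integer $k$ for which there exist an integer $n\geq 1$ and a continuous $\Phi:A\to\mathbb C^k\setminus\{0\}$ with $\Phi(L(\theta)x)=e^{in\theta}\Phi(x)$ for all $\theta\in S^1$, $x\in A$; $\operatorname{ind}(A)=+\infty$ if no such map exists; $\operatorname{ind}(\emptyset)=0$. For a positive integer $j$, $\mathcal G_j=\{A\subset X: A\text{ compact, invariant, }\operatorname{ind}(A)\geq j\}$ and $c_j=\inf_{A\in\mathcal G_j}\max_A\mathcal J$. For $c\in\mathbb R$, $K_c=\{q\in X:\mathcal J(q)=c,\ \mathcal J'(q)=0\}$; if $q\in K_c$ then $\mathcal O(q)\subset K_c$ is called a critical orbit at the level $c$. $\mathcal J$ satisfies the $(wPS)_c$-condition if every sequence $(q_n)\subset X$ with $\mathcal J(q_n)\to c$ and $\mathcal J'(q_n)\to0$ has a subsequence converging in $Y$ (i.e. in $\|\cdot\|_Y$) to some $q^*\in X$ with $\mathcal J(q^* )=c$ and $\mathcal J'(q^* )=0$. *)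

theory Defs
  imports "HOL-Analysis.Analysis" "HOL-Library.Extended_Nat" "HOL-Library.Extended_Real"
begin

definition compact_operator :: "('a::real_normed_vector \<Rightarrow> 'b::real_normed_vector) \<Rightarrow> bool" where
  "compact_operator T \<longleftrightarrow>
     bounded_linear T \<and> (\<forall>B. bounded B \<longrightarrow> compact (closure (T ` B)))"

text \<open>The circle \<open>\<real>/2\<pi>\<int>\<close> is represented by \<open>2\<pi>\<close>-periodicity in a real parameter. The quotient map
  is open, so joint continuity on \<open>\<real> \<times> X\<close> is joint continuity on \<open>S\<^sup>1 \<times> X\<close>.\<close>

definition isometric_S1_rep :: "(real \<Rightarrow> 'a::real_normed_vector \<Rightarrow> 'a) \<Rightarrow> bool" where
  "isometric_S1_rep L \<longleftrightarrow>
     (\<forall>\<theta>. bounded_linear (L \<theta>)) \<and>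
     (\<forall>\<theta>. L (\<theta> + 2 * pi) = L \<theta>) \<and>
     L 0 = id \<and>
     (\<forall>\<theta>\<^sub>1 \<theta>\<^sub>2. L (\<theta>\<^sub>1 + \<theta>\<^sub>2) = L \<theta>\<^sub>1 \<circ> L \<theta>\<^sub>2) \<and>
     continuous_on UNIV (\<lambda>(\<theta>, x). L \<theta> x) \<and>
     (\<forall>\<theta> x. norm (L \<theta> x) = norm x)"

text \<open>The inclusion of \<open>X\<close> in \<open>Y\<close> is an injection \<open>\<iota>\<close> between two types. The restriction of \<open>L\<close> to
  \<open>X\<close> is meaningful when \<open>\<iota>\<close> is injective and every \<open>L \<theta>\<close> maps \<open>range \<iota>\<close> into itself.\<close>

definition restrict_rep :: "('x \<Rightarrow> 'y) \<Rightarrow> (real \<Rightarrow> 'y \<Rightarrow> 'y) \<Rightarrow> real \<Rightarrow> 'x \<Rightarrow> 'x" where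
  "restrict_rep \<iota> L \<theta> x = inv \<iota> (L \<theta> (\<iota> x))"

definition Fix_S1 :: "(real \<Rightarrow> 'a \<Rightarrow> 'a) \<Rightarrow> 'a set" where
  "Fix_S1 L = {y. \<forall>\<theta>. L \<theta> y = y}"

definition orbit_S1 :: "(real \<Rightarrow> 'a \<Rightarrow> 'a) \<Rightarrow> 'a \<Rightarrow> 'a set" where
  "orbit_S1 L y = {L \<theta> y | \<theta>. True}"

definition invariant_set :: "(real \<Rightarrow> 'a \<Rightarrow> 'a) \<Rightarrow> 'a set \<Rightarrow> bool" where
  "invariant_set L A \<longleftrightarrow> (\<forall>\<theta>. L \<theta> ` A = A)"

definition invariant_functional :: "(real \<Rightarrow> 'a \<Rightarrow> 'a) \<Rightarrow> ('a \<Rightarrow> real) \<Rightarrow> bool" where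
  "invariant_functional L J \<longleftrightarrow> (\<forall>\<theta>. J \<circ> L \<theta> = J)"

text \<open>A map \<open>A \<rightarrow> \<complex>\<^sup>k \<setminus> {0}\<close> is given by its coordinates \<open>\<Phi> x i\<close>, \<open>i < k\<close>; the values at \<open>i \<ge> k\<close>
  are irrelevant.\<close>

definition equivariant_map ::
    "(real \<Rightarrow> 'a::topological_space \<Rightarrow> 'a) \<Rightarrow> 'a set \<Rightarrow> nat \<Rightarrow> nat \<Rightarrow> ('a \<Rightarrow> nat \<Rightarrow> complex) \<Rightarrow> bool" where
  "equivariant_map L A k n \<Phi> \<longleftrightarrow>
     (\<forall>i<k. continuous_on A (\<lambda>x. \<Phi> x i)) \<and>
     (\<forall>x\<in>A. \<exists>i<k. \<Phi> x i \<noteq> 0) \<and>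
     (\<forall>\<theta>. \<forall>x\<in>A. \<forall>i<k. \<Phi> (L \<theta> x) i = exp (\<i> * of_nat n * of_real \<theta>) * \<Phi> x i)"

text \<open>In \<^typ>\<open>enat\<close> the infimum of the empty set is \<open>\<infinity>\<close>. For \<open>A = {}\<close> the value \<open>k = 0\<close> is
  admissible, so the index of the empty set is \<open>0\<close>.\<close>

definition S1_index :: "(real \<Rightarrow> 'a::topological_space \<Rightarrow> 'a) \<Rightarrow> 'a set \<Rightarrow> enat" where
  "S1_index L A = Inf {enat k | k. \<exists>n\<ge>1. \<exists>\<Phi>. equivariant_map L A k n \<Phi>}"

definition index_class :: "(real \<Rightarrow> 'a::topological_space \<Rightarrow> 'a) \<Rightarrow> nat \<Rightarrow> 'a set set" where
  "index_class L j = {A. compact A \<and> invariant_set L A \<and> S1_index L A \<ge> enat j}"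

text \<open>For \<open>j \<ge> 1\<close> the members of \<open>index_class L j\<close> are compact and nonempty, so for continuous \<open>J\<close>
  the inner supremum is a maximum.\<close>

definition minimax_level :: "(real \<Rightarrow> 'a::topological_space \<Rightarrow> 'a) \<Rightarrow> ('a \<Rightarrow> real) \<Rightarrow> nat \<Rightarrow> ereal" where
  "minimax_level L J j = (INF A\<in>index_class L j. SUP x\<in>A. ereal (J x))"

definition is_C1_with_derivative ::
    "('a::real_normed_vector \<Rightarrow> real) \<Rightarrow> ('a \<Rightarrow> 'a \<Rightarrow>\<^sub>L real) \<Rightarrow> bool" where
  "is_C1_with_derivative J J' \<longleftrightarrow>
     (\<forall>x. (J has_derivative blinfun_apply (J' x)) (at x)) \<and> continuous_on UNIV J'"

definition critical_set ::
    "('a::real_normed_vector \<Rightarrow> real) \<Rightarrow> ('a \<Rightarrow> 'a \<Rightarrow>\<^sub>L real) \<Rightarrow> real \<Rightarrow> 'a set" where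
  "critical_set J J' c = {q. J q = c \<and> J' q = 0}"

definition wPS ::
    "('x::real_normed_vector \<Rightarrow> 'y::real_normed_vector) \<Rightarrow>
     ('x \<Rightarrow> real) \<Rightarrow> ('x \<Rightarrow> 'x \<Rightarrow>\<^sub>L real) \<Rightarrow> real \<Rightarrow> bool" where
  "wPS \<iota> J J' c \<longleftrightarrow>
     (\<forall>q :: nat \<Rightarrow> 'x.
        (\<lambda>n. J (q n)) \<longlonglongrightarrow> c \<and> (\<lambda>n. J' (q n)) \<longlonglongrightarrow> 0 \<longrightarrow>
        (\<exists>r q'. strict_mono r \<and> (\<lambda>n. \<iota> (q (r n))) \<longlonglongrightarrow> \<iota> q' \<and> J q' = c \<and> J' q' = 0))"

lemma S1_index_empty: "S1_index L {} = 0"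
proof -
  have "equivariant_map L {} 0 1 (\<lambda>_ _. 0)"
    by (simp add: equivariant_map_def)
  then have "enat 0 \<in> {enat k | k. \<exists>n\<ge>1. \<exists>\<Phi>. equivariant_map L {} k n \<Phi>}"
    by blast
  then have "S1_index L {} \<le> enat 0"
    unfolding S1_index_def by (rule Inf_lower)
  then show ?thesis by (simp add: enat_0)
qed

lemma S1_index_fixed_point:
  assumes "x \<in> A" "\<And>\<theta>. L \<theta> x = x"
  shows "S1_index L A = \<infinity>"
proof -
  have False if n: "n \<ge> 1" and eq: "equivariant_map L A k n \<Phi>" for k n \<Phi>
  proof -
    obtain i where i: "i < k" "\<Phi> x i \<noteq> 0"
      using eq assms(1) unfolding equivariant_map_def by blast
    have "\<Phi> (L (pi / real n) x) i = exp (\<i> * of_nat n * of_real (pi / real n)) * \<Phi> x i"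
      using eq assms(1) i(1) unfolding equivariant_map_def by blast
    moreover have "\<i> * of_nat n * of_real (pi / real n) = \<i> * complex_of_real pi"
      using n by simp
    moreover have "exp (\<i> * complex_of_real pi) = -1"
      using exp_pi_i' by simp
    ultimately have "\<Phi> x i = - \<Phi> x i"
      using assms(2) by simp
    then show False using i(2) by simp
  qed
  then have "{enat k | k. \<exists>n\<ge>1. \<exists>\<Phi>. equivariant_map L A k n \<Phi>} = {}"
    by blast
  then show ?thesis
    unfolding S1_index_def by (simp add: Inf_enat_def)
qed

text \<open>The singleton \<open>{0}\<close> belongs to every class, so \<open>-\<infinity> < minimax_level L J j\<close> already means that
  the level is a real number.\<close>

lemma minimax_level_less_infinity:
  assumes "isometric_S1_rep L"
  shows "minimax_level L J j < \<infinity>"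
proof -
  have fixed: "L \<theta> 0 = 0" for \<theta>
    using assms linear_0[OF bounded_linear.linear] unfolding isometric_S1_rep_def by blast
  then have "{0} \<in> index_class L j"
    by (simp add: index_class_def invariant_set_def S1_index_fixed_point[of 0])
  then have "minimax_level L J j \<le> (SUP x\<in>{0}. ereal (J x))"
    unfolding minimax_level_def by (rule INF_lower)
  also have "\<dots> < \<infinity>" by simp
  finally show ?thesis .
qed

end

theory Submission
  imports Defs
begin

text \<open>
  Let \<open>c\<close> be the minimax level of \<open>j\<close> and \<open>A\<close> a set of the class on which \<open>J \<le> c + \<kappa>\<^sup>2\<close>. Instead of pushing \<open>A\<close>
  down along a pseudo-gradient flow, the proof applies Ekeland's variational principle to the complete space of
  equivariant bounded continuous perturbations \<open>g\<close> of the identity, with the functional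
  \<open>g \<mapsto> max {J (x + g x) | x \<in> A}\<close>. This functional is bounded below by \<open>c\<close>, since equivariant images of \<open>A\<close> stay
  in the class. The gradient of an invariant \<open>J\<close> is continuous and equivariant, so a small step against the gradient is
  an admissible variation. The principle yields (\<open>minimax_almost_critical\<close>) a point \<open>z\<close> at distance at most
  \<open>\<kappa>\<close> from \<open>A\<close> with \<open>c \<le> J z \<le> c + \<kappa>\<^sup>2\<close> and \<open>\<parallel>J' z\<parallel>\<^sup>2 \<le> \<kappa>\<close>. Letting \<open>\<kappa>\<close> tend to zero gives a Palais-Smale sequence,
  and \<open>wPS\<close> a critical point at level \<open>c\<close>.

  For the multiplicity statement suppose that there are only finitely many critical orbits at the level \<open>c\<close>. None of
  them is a fixed point, so their images in the larger space form a compact set \<open>K\<close>, and a weighted average over the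
  circle produces a continuous equivariant complex function that has no zeros near \<open>K\<close>
  (\<open>equivariant_function_on_finite_orbits\<close>). Hence removing a neighbourhood of \<open>K\<close> from a set lowers its index by at
  most one (\<open>index_class_excision\<close>), and almost optimal sets for \<open>k\<close> become almost optimal sets for \<open>j\<close> that avoid this
  neighbourhood. As \<open>z\<close> lies close to the set that it comes from, the Palais-Smale sequence obtained from these sets
  stays away from \<open>K\<close>, whereas \<open>wPS\<close> forces a subsequence to converge to a point of \<open>K\<close>. The neighbourhood of \<open>K\<close>
  is measured in the norm of the larger space, the only one in which \<open>wPS\<close> provides compactness.
\<close>

section \<open>The gradient of a functional on a Hilbert space\<close>

text \<open>The representing vector of \<open>\<phi>\<close> is the minimiser of \<open>\<parallel>x\<parallel>\<^sup>2 / 2 - \<phi> x\<close>: by the parallelogram law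
  every minimising sequence is Cauchy, and the first-order condition at the minimiser \<open>g\<close> reads
  \<open>g \<bullet> v = \<phi> v\<close>.\<close>

lemma riesz_exists:
  fixes \<phi> :: "'a::{real_inner,complete_space} \<Rightarrow>\<^sub>L real"
  shows "\<exists>g. \<forall>v. g \<bullet> v = blinfun_apply \<phi> v"
proof -
  define F where "F x = (norm x)\<^sup>2 / 2 - \<phi> x" for x
  have F_expand: "F (x + h) = F x + (x \<bullet> h - \<phi> h) + (norm h)\<^sup>2 / 2" for x h
    by (simp add: F_def power2_norm_eq_inner inner_add_left inner_add_right inner_commute
        blinfun.add_right algebra_simps)
  have "F x \<ge> - (norm \<phi>)\<^sup>2 / 2" for x
  proof -
    have "\<phi> x \<le> norm \<phi> * norm x"
      using norm_blinfun[of \<phi> x] by auto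
    moreover have "0 \<le> (norm x - norm \<phi>)\<^sup>2" by simp
    ultimately show ?thesis
      by (simp add: F_def power2_diff algebra_simps)
  qed
  then have bdd: "bdd_below (range F)" by (intro bdd_belowI[of _ "- (norm \<phi>)\<^sup>2 / 2"]) auto
  define m where "m = (INF x. F x)"
  have m_le: "m \<le> F x" for x
    unfolding m_def by (rule cINF_lower[OF bdd]) simp
  have "\<exists>x. F x < m + inverse (Suc n)" for n
    using cINF_less_iff[OF _ bdd, of "m + inverse (Suc n)"] m_def by auto
  then obtain x where x: "F (x n) < m + inverse (Suc n)" for n by metis
  have close: "(norm (x i - x j))\<^sup>2 / 4 \<le> inverse (Suc i) + inverse (Suc j)" for i j
  proof -
    \<comment> \<open>the parallelogram law; the linear part of F cancels\<close>
    have "F (x i) + F (x j) - 2 * F ((1/2) *\<^sub>R (x i + x j)) = (norm (x i - x j))\<^sup>2 / 4"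
      by (simp add: F_def power2_norm_eq_inner blinfun.add_right blinfun.scaleR_right
          inner_add_left inner_add_right inner_diff_left inner_diff_right inner_commute field_simps)
    then show ?thesis
      using m_le[of "(1/2) *\<^sub>R (x i + x j)"] x[of i] x[of j] by linarith
  qed
  have "Cauchy x"
  proof (rule metric_CauchyI)
    fix e :: real assume e: "e > 0"
    obtain N where N: "inverse (real (Suc N)) < e\<^sup>2 / 8"
      using reals_Archimedean[of "e\<^sup>2 / 8"] e by auto
    show "\<exists>M. \<forall>i\<ge>M. \<forall>j\<ge>M. dist (x i) (x j) < e"
    proof (intro exI allI impI)
      fix i j assume ij: "N \<le> i" "N \<le> j"
      have "inverse (real (Suc i)) \<le> inverse (real (Suc N))" "inverse (real (Suc j)) \<le> inverse (real (Suc N))"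
        using ij by (auto intro!: le_imp_inverse_le)
      then have "(norm (x i - x j))\<^sup>2 < e\<^sup>2" using close[of i j] N by linarith
      then show "dist (x i) (x j) < e"
        using e power_less_imp_less_base[of "norm (x i - x j)" 2 e] by (simp add: dist_norm)
    qed
  qed
  then obtain g where g: "x \<longlonglongrightarrow> g" using Cauchy_convergent convergent_def by blast
  have "(\<lambda>n. F (x n)) \<longlonglongrightarrow> F g"
    unfolding F_def by (intro tendsto_intros g) simp
  moreover have "(\<lambda>n. m + inverse (Suc n)) \<longlonglongrightarrow> m"
    using tendsto_add[OF tendsto_const LIMSEQ_inverse_real_of_nat, of m] by simp
  moreover have "\<forall>n. F (x n) \<le> m + inverse (Suc n)"
    using x less_imp_le by blast
  ultimately have "F g \<le> m"
    by (intro LIMSEQ_le) auto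
  then have min: "F g \<le> F y" for y using m_le order_trans by blast
  have half: "0 \<le> g \<bullet> v - \<phi> v" for v
  proof (rule ccontr)
    assume neg: "\<not> 0 \<le> g \<bullet> v - \<phi> v"
    define a where "a = \<phi> v - g \<bullet> v"
    have a: "a > 0" using neg a_def by simp
    then have v: "norm v > 0" using a_def by auto
    \<comment> \<open>the step length that minimises F along the descent direction v\<close>
    define t where "t = a / (norm v)\<^sup>2"
    have "F g \<le> F (g + t *\<^sub>R v)" by (rule min)
    also have "\<dots> = F g - t * a + t\<^sup>2 * (norm v)\<^sup>2 / 2"
      by (simp add: F_expand a_def blinfun.scaleR_right power_mult_distrib algebra_simps)
    also have "t\<^sup>2 * (norm v)\<^sup>2 = t * a"
      using v by (simp add: t_def power2_eq_square)
    finally have "t * a \<le> 0" by (simp add: mult.commute)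
    moreover have "t * a > 0" using a v by (simp add: t_def)
    ultimately show False by simp
  qed
  have "g \<bullet> v = blinfun_apply \<phi> v" for v
    using half[of v] half[of "-v"] by (simp add: blinfun.minus_right)
  then show ?thesis by (intro exI allI)
qed

definition riesz :: "('a::{real_inner,complete_space} \<Rightarrow>\<^sub>L real) \<Rightarrow> 'a" where
  "riesz \<phi> = (SOME g. \<forall>v. g \<bullet> v = blinfun_apply \<phi> v)"

lemma inner_riesz: "riesz \<phi> \<bullet> v = blinfun_apply \<phi> v"
  unfolding riesz_def using someI_ex[OF riesz_exists[of \<phi>]] by blast

lemma riesz_unique: "(\<And>v. g \<bullet> v = blinfun_apply \<phi> v) \<Longrightarrow> riesz \<phi> = g"
  using vector_eq_rdot[of "riesz \<phi>" g] by (simp add: inner_riesz)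

lemma riesz_diff: "riesz (\<phi> - \<psi>) = riesz \<phi> - riesz \<psi>"
  by (rule riesz_unique) (simp add: inner_diff_left inner_riesz blinfun.diff_left)

lemma norm_riesz: "norm (riesz \<phi>) = norm \<phi>"
proof (rule antisym)
  have "blinfun_apply \<phi> (riesz \<phi>) = norm (riesz \<phi>) * norm (riesz \<phi>)"
    using power2_norm_eq_inner[of "riesz \<phi>"] by (simp add: inner_riesz power2_eq_square)
  then have "norm (riesz \<phi>) * norm (riesz \<phi>) \<le> norm \<phi> * norm (riesz \<phi>)"
    using norm_blinfun[of \<phi> "riesz \<phi>"] by simp
  then show "norm (riesz \<phi>) \<le> norm \<phi>"
    by (cases "norm (riesz \<phi>) = 0") auto
  show "norm \<phi> \<le> norm (riesz \<phi>)"
    by (rule norm_blinfun_bound) (auto simp flip: inner_riesz intro: Cauchy_Schwarz_ineq2)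
qed

lemma continuous_on_riesz [continuous_intros]:
  assumes "continuous_on S f"
  shows "continuous_on S (\<lambda>x. riesz (f x))"
proof -
  have "continuous_on UNIV (riesz :: ('b \<Rightarrow>\<^sub>L real) \<Rightarrow> 'b)"
    using continuous_onI[of UNIV "riesz :: ('b \<Rightarrow>\<^sub>L real) \<Rightarrow> 'b"] 
    by (metis dist_norm norm_riesz riesz_diff less_imp_le)
  then show ?thesis
    using continuous_on_compose2[OF _ assms, of UNIV riesz] by auto
qed

section \<open>Ekeland's variational principle\<close>

text \<open>The sets \<open>D v\<close> of points that improve on \<open>v\<close> by at least \<open>\<kappa>\<close> times their distance to \<open>v\<close> are closed and
  nested along any sequence that moves each time into the current set. Moving at step \<open>n\<close> to a point within
  \<open>1 / (n + 1)\<close> of the infimum of \<open>\<Psi>\<close> on the current set makes their diameters tend to zero, so they shrink to a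
  single point, and that point admits no improvement.\<close>

lemma ekeland_variational_principle:
  fixes S :: "'a::complete_space set" and \<Psi> :: "'a \<Rightarrow> real"
  assumes "closed S" and "u \<in> S" and kappa_pos: "\<kappa> > 0"
    and below: "\<And>w. w \<in> S \<Longrightarrow> c \<le> \<Psi> w"
    and lsc: "\<And>w a. w \<in> S \<Longrightarrow> a < \<Psi> w \<Longrightarrow> eventually (\<lambda>w'. a < \<Psi> w') (nhds w)"
  obtains v where "v \<in> S" "\<Psi> v + \<kappa> * dist u v \<le> \<Psi> u"
    "\<And>w. w \<in> S \<Longrightarrow> \<Psi> v \<le> \<Psi> w + \<kappa> * dist v w"
proof -
  define D where "D v = {w \<in> S. \<Psi> w + \<kappa> * dist v w \<le> \<Psi> v}" for v
  have D_self: "v \<in> D v" if "v \<in> S" for v using that by (simp add: D_def)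
  have D_trans: "D w \<subseteq> D v" if "w \<in> D v" for v w
  proof
    fix z assume z: "z \<in> D w"
    have "\<kappa> * dist v z \<le> \<kappa> * (dist v w + dist w z)"
      using kappa_pos dist_triangle by (intro mult_left_mono) auto
    then show "z \<in> D v" using z that by (auto simp: D_def algebra_simps)
  qed
  have D_closed: "w \<in> D v" if "\<And>n. x n \<in> D v" and "x \<longlonglongrightarrow> w" for v w x
  proof -
    have "w \<in> S" using that assms(1) by (auto simp: D_def intro: closed_sequentially)
    moreover have "\<Psi> w \<le> \<Psi> v - \<kappa> * dist v w"
    proof (rule ccontr)
      assume "\<not> ?thesis"
      then obtain a where a: "\<Psi> v - \<kappa> * dist v w < a" "a < \<Psi> w" using dense by (metis not_le)
      have "\<forall>\<^sub>F n in sequentially. a < \<Psi> (x n)"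
        using lsc[OF \<open>w \<in> S\<close> a(2)] that(2) by (auto simp: filterlim_iff)
      then have "\<forall>\<^sub>F n in sequentially. a \<le> \<Psi> v - \<kappa> * dist v (x n)"
      proof eventually_elim
        case (elim n) then show ?case using that(1)[of n] by (auto simp: D_def)
      qed
      moreover have "(\<lambda>n. \<Psi> v - \<kappa> * dist v (x n)) \<longlonglongrightarrow> \<Psi> v - \<kappa> * dist v w"
        by (intro tendsto_intros that)
      ultimately have "a \<le> \<Psi> v - \<kappa> * dist v w"
        using tendsto_lowerbound by fastforce
      then show False using a by simp
    qed
    ultimately show ?thesis by (simp add: D_def)
  qed
  define m where "m v = (INF w\<in>D v. \<Psi> w)" for v
  have bdd: "bdd_below (\<Psi> ` D v)" for v
    using below by (auto simp: D_def intro!: bdd_belowI[of _ c])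
  have m_le: "m v \<le> \<Psi> w" if "w \<in> D v" for v w
    unfolding m_def using bdd that by (rule cINF_lower)
  have "\<exists>w\<in>D v. \<Psi> w < m v + e" if "v \<in> S" "e > 0" for v e
    using cINF_less_iff[OF _ bdd, of v "m v + e"] D_self[OF that(1)] that(2) m_def by auto
  then have "\<forall>n v. v \<in> S \<longrightarrow> (\<exists>w\<in>D v. \<Psi> w < m v + inverse (Suc n))" by auto
  then obtain s where s: "v \<in> S \<Longrightarrow> s n v \<in> D v \<and> \<Psi> (s n v) < m v + inverse (Suc n)" for n v
    by metis
  define x where "x = rec_nat u s"
  have x0: "x 0 = u" and xS: "x (Suc n) = s n (x n)" for n by (simp_all add: x_def)
  have x_in: "x n \<in> S" for n
    by (induction n) (use s assms(2) in \<open>auto simp: x0 xS D_def\<close>)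
  have x_step: "x (Suc n) \<in> D (x n)" and x_min: "\<Psi> (x (Suc n)) < m (x n) + inverse (Suc n)" for n
    using s[OF x_in[of n]] by (auto simp: xS)
  have D_anti: "D (x (n + k)) \<subseteq> D (x n)" for n k
  proof (induction k)
    case (Suc k)
    then show ?case using D_trans[OF x_step[of "n + k"]] by auto
  qed simp
  have x_D: "x j \<in> D (x i)" if "i \<le> j" for i j
    using D_anti[of i "j - i"] D_self[OF x_in[of j]] that by auto
  have diam: "\<kappa> * dist (x (Suc n)) w < inverse (Suc n)" if "w \<in> D (x (Suc n))" for n w
  proof -
    have "w \<in> D (x n)" using that D_trans[OF x_step] by blast
    then show ?thesis using m_le[of w "x n"] x_min[of n] that by (auto simp: D_def)
  qed
  have "Cauchy x"
  proof (rule metric_CauchyI)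
    fix e :: real assume e: "e > 0"
    obtain N where N: "inverse (real (Suc N)) < \<kappa> * e / 2"
      using reals_Archimedean[of "\<kappa> * e / 2"] e kappa_pos by auto
    have near: "dist (x (Suc N)) (x i) < e / 2" if "i \<ge> Suc N" for i
    proof -
      have "\<kappa> * dist (x (Suc N)) (x i) < \<kappa> * (e / 2)" using diam[OF x_D[OF that]] N by simp
      then show ?thesis using kappa_pos by (simp only: mult_less_cancel_left_pos)
    qed
    show "\<exists>M. \<forall>i\<ge>M. \<forall>j\<ge>M. dist (x i) (x j) < e"
      using dist_triangle_half_r[OF near near] by blast
  qed
  then obtain v where v: "x \<longlonglongrightarrow> v" using Cauchy_convergent convergent_def by blast
  have v_D: "v \<in> D (x n)" for n
    by (rule D_closed[of "\<lambda>k. x (k + n)"]) (use x_D v LIMSEQ_ignore_initial_segment in auto)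
  show ?thesis
  proof (rule that[of v])
    show "v \<in> S" "\<Psi> v + \<kappa> * dist u v \<le> \<Psi> u" using v_D[of 0] by (auto simp: D_def x0)
    fix w assume w: "w \<in> S"
    show "\<Psi> v \<le> \<Psi> w + \<kappa> * dist v w"
    proof (rule ccontr)
      assume neg: "\<not> ?thesis"
      then have wD: "w \<in> D v" using w by (simp add: D_def)
      then have "w \<in> D (x n)" for n using D_trans[OF v_D] by blast
      then have "\<kappa> * dist (x (Suc n)) w \<le> inverse (Suc n)" for n using diam less_imp_le by blast
      moreover have "(\<lambda>n. \<kappa> * dist (x (Suc n)) w) \<longlonglongrightarrow> \<kappa> * dist v w"
        by (intro tendsto_intros LIMSEQ_Suc v)
      ultimately have "\<kappa> * dist v w \<le> 0"
        using LIMSEQ_le[OF _ LIMSEQ_inverse_real_of_nat, of "\<lambda>n. \<kappa> * dist (x (Suc n)) w"] by blast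
      then have "dist v w = 0" using kappa_pos by (smt (verit) mult_pos_pos zero_le_dist)
      then show False using neg by simp
    qed
  qed
qed

section \<open>Isometric representations of the circle and the index\<close>

lemma isometric_S1_repD:
  assumes "isometric_S1_rep R"
  shows rep_bounded_linear: "bounded_linear (R \<theta>)"
    and rep_period: "R (\<theta> + 2 * pi) x = R \<theta> x"
    and rep_zero: "R 0 x = x"
    and rep_add: "R (\<alpha> + \<beta>) x = R \<alpha> (R \<beta> x)"
    and rep_norm: "norm (R \<theta> x) = norm x"
    and rep_cont: "continuous_on UNIV (\<lambda>p. R (fst p) (snd p))"
  using assms by (simp_all add: isometric_S1_rep_def case_prod_beta del: add_uminus_conv_diff) (metis comp_apply)

lemma rep_inverse:
  assumes "isometric_S1_rep R"
  shows "R (- \<theta>) (R \<theta> x) = x" "R \<theta> (R (- \<theta>) x) = x"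
  using rep_add[OF assms, of "- \<theta>" \<theta>] rep_add[OF assms, of \<theta> "- \<theta>"] rep_zero[OF assms] by auto

lemma rep_dist:
  assumes "isometric_S1_rep R"
  shows "dist (R \<theta> x) (R \<theta> y) = dist x y"
  using rep_norm[OF assms, of \<theta> "x - y"] linear_diff[OF bounded_linear.linear[OF rep_bounded_linear[OF assms]]]
  by (metis dist_norm)

lemma continuous_on_rep:
  assumes "isometric_S1_rep R" "continuous_on S f" "continuous_on S g"
  shows "continuous_on S (\<lambda>x. R (f x) (g x))"
  using continuous_on_compose2[OF rep_cont[OF assms(1)] continuous_on_Pair[OF assms(2,3)]] by simp

text \<open>Polarization: a linear isometry preserves the inner product.\<close>

lemma rep_inner:
  fixes R :: "real \<Rightarrow> 'a::real_inner \<Rightarrow> 'a"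
  assumes "isometric_S1_rep R"
  shows "R \<theta> x \<bullet> R \<theta> y = x \<bullet> y"
proof -
  have "R \<theta> (x + y) = R \<theta> x + R \<theta> y"
    using linear_add[OF bounded_linear.linear[OF rep_bounded_linear[OF assms]]] .
  then show ?thesis
    using rep_norm[OF assms, of \<theta>] by (simp add: dot_norm) (metis)
qed

lemma invariant_setD: "invariant_set R A \<Longrightarrow> x \<in> A \<Longrightarrow> R \<theta> x \<in> A"
  unfolding invariant_set_def by blast

lemma invariant_setI:
  assumes "isometric_S1_rep R" "\<And>\<theta> x. x \<in> A \<Longrightarrow> R \<theta> x \<in> A"
  shows "invariant_set R A"
  unfolding invariant_set_def
proof (intro allI equalityI subsetI)
  fix \<theta> x assume "x \<in> A"
  then have "R \<theta> (R (- \<theta>) x) \<in> R \<theta> ` A" using assms(2) by blast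
  then show "x \<in> R \<theta> ` A" using rep_inverse(2)[OF assms(1)] by simp
qed (use assms(2) in auto)

lemma index_ge_iff:
  "enat j \<le> S1_index R A \<longleftrightarrow> (\<forall>k n \<Phi>. 1 \<le> n \<longrightarrow> equivariant_map R A k n \<Phi> \<longrightarrow> j \<le> k)"
  unfolding S1_index_def le_Inf_iff by fastforce

text \<open>An equivariant map on the image pulls back along \<open>f\<close>, so the index cannot drop under \<open>f\<close>. This is the only
  property of the index that the deformation argument needs.\<close>

lemma index_class_image:
  assumes R: "isometric_S1_rep R" and A: "A \<in> index_class R j"
    and cont: "continuous_on A f" and eqv: "\<And>\<theta> x. f (R \<theta> x) = R \<theta> (f x)"
  shows "f ` A \<in> index_class R j"
proof -
  have inv: "R \<theta> x \<in> A" if "x \<in> A" for \<theta> x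
    using A that by (auto simp: index_class_def intro: invariant_setD)
  have "invariant_set R (f ` A)"
    using inv eqv by (intro invariant_setI[OF R]) (metis imageE imageI)
  moreover have "equivariant_map R A k n (\<lambda>x. \<Phi> (f x))" if "equivariant_map R (f ` A) k n \<Phi>" for k n \<Phi>
    using that continuous_on_compose2[OF _ cont order_refl]
    by (auto simp: equivariant_map_def eqv)
  then have "enat j \<le> S1_index R (f ` A)"
    using A unfolding index_class_def index_ge_iff by blast
  ultimately show ?thesis
    using A compact_continuous_image[OF cont] by (auto simp: index_class_def)
qed

lemma index_class_nonempty: "0 < j \<Longrightarrow> A \<in> index_class R j \<Longrightarrow> A \<noteq> {}"
  by (auto simp: index_class_def S1_index_empty enat_0_iff)

definition grad :: "('a \<Rightarrow> 'a::{real_inner,complete_space} \<Rightarrow>\<^sub>L real) \<Rightarrow> 'a \<Rightarrow> 'a" where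
  "grad J' x = riesz (J' x)"

text \<open>Differentiating \<open>J \<circ> R \<theta> = J\<close> gives \<open>J' (R \<theta> x) \<circ> R \<theta> = J' x\<close>, and \<open>R \<theta>\<close> is an orthogonal map with
  inverse \<open>R (- \<theta>)\<close>. The gradient is therefore an equivariant vector field without any averaging.\<close>

lemma grad_equivariant:
  fixes R :: "real \<Rightarrow> 'a::{real_inner,complete_space} \<Rightarrow> 'a"
  assumes R: "isometric_S1_rep R" and inv: "invariant_functional R J"
    and deriv: "\<And>x. (J has_derivative blinfun_apply (J' x)) (at x)"
  shows "grad J' (R \<theta> x) = R \<theta> (grad J' x)"
proof -
  have "J \<circ> R \<theta> = J" using inv by (simp add: invariant_functional_def)
  moreover have "(J \<circ> R \<theta> has_derivative blinfun_apply (J' (R \<theta> x)) \<circ> R \<theta>) (at x)"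
    by (intro diff_chain_at bounded_linear_imp_has_derivative rep_bounded_linear[OF R] deriv)
  ultimately have eq: "blinfun_apply (J' (R \<theta> x)) \<circ> R \<theta> = blinfun_apply (J' x)"
    using has_derivative_unique[OF _ deriv] by metis
  show ?thesis
    unfolding grad_def
  proof (rule riesz_unique)
    fix v
    have "R \<theta> (riesz (J' x)) \<bullet> v = riesz (J' x) \<bullet> R (- \<theta>) v"
      by (metis R rep_inner rep_inverse(2))
    also have "\<dots> = blinfun_apply (J' (R \<theta> x)) (R \<theta> (R (- \<theta>) v))"
      by (metis eq comp_apply inner_riesz)
    also have "\<dots> = blinfun_apply (J' (R \<theta> x)) v"
      by (simp add: rep_inverse(2)[OF R])
    finally show "R \<theta> (riesz (J' x)) \<bullet> v = blinfun_apply (J' (R \<theta> x)) v" .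
  qed
qed

section \<open>Almost critical points near almost optimal sets\<close>

text \<open>The mean value theorem turns each difference quotient into a derivative at a point between
  \<open>z n\<close> and \<open>z n - t n *\<^sub>R v n\<close>; continuity of \<open>J'\<close> then allows base point, direction and step to vary together.
  The uniform version is needed because the maximum points of the perturbed functional move with the step size.\<close>

lemma derivative_le_of_difference_quotients:
  fixes J :: "'a::real_normed_vector \<Rightarrow> real"
  assumes deriv: "\<And>x. (J has_derivative blinfun_apply (J' x)) (at x)"
    and cont: "continuous_on UNIV J'"
    and z: "z \<longlonglongrightarrow> z0" and v: "v \<longlonglongrightarrow> v0" and t: "t \<longlonglongrightarrow> 0" "\<And>n. 0 < t n"
    and decr: "\<And>n. J (z n) - \<kappa> * t n \<le> J (z n - t n *\<^sub>R v n)"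
  shows "blinfun_apply (J' z0) v0 \<le> \<kappa>"
proof -
  have "\<exists>s. 0 < s \<and> s < t n \<and> blinfun_apply (J' (z n - s *\<^sub>R v n)) (v n) \<le> \<kappa>" for n
  proof -
    have "((\<lambda>s. J (z n - s *\<^sub>R v n)) has_derivative (\<lambda>h. blinfun_apply (J' (z n - s *\<^sub>R v n)) (- h *\<^sub>R v n)))
        (at s within {0..t n})" for s
      by (rule has_derivative_compose[OF _ deriv]) (auto intro!: derivative_eq_intros)
    from mvt_simple[OF t(2) this] obtain s where s: "s \<in> {0<..<t n}"
      "J (z n - t n *\<^sub>R v n) - J (z n - 0 *\<^sub>R v n) = blinfun_apply (J' (z n - s *\<^sub>R v n)) (- (t n - 0) *\<^sub>R v n)"
      by blast
    have "t n * blinfun_apply (J' (z n - s *\<^sub>R v n)) (v n) \<le> t n * \<kappa>"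
      using s(2) decr[of n] by (simp add: blinfun.scaleR_right blinfun.minus_right algebra_simps)
    then show ?thesis using s(1) t(2)[of n] by auto
  qed
  then obtain s where s: "\<And>n. 0 < s n" "\<And>n. s n < t n"
    "\<And>n. blinfun_apply (J' (z n - s n *\<^sub>R v n)) (v n) \<le> \<kappa>" by metis
  have "s \<longlonglongrightarrow> 0"
    by (rule tendsto_sandwich[OF _ _ tendsto_const t(1)]) (simp_all add: s less_imp_le)
  then have "(\<lambda>n. z n - s n *\<^sub>R v n) \<longlonglongrightarrow> z0 - 0 *\<^sub>R v0"
    by (intro tendsto_intros z v)
  then have "(\<lambda>n. J' (z n - s n *\<^sub>R v n)) \<longlonglongrightarrow> J' z0"
    using continuous_on_tendsto_compose[OF cont] by simp
  then have "(\<lambda>n. blinfun_apply (J' (z n - s n *\<^sub>R v n)) (v n)) \<longlonglongrightarrow> blinfun_apply (J' z0) v0"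
    by (intro blinfun.tendsto v)
  then show ?thesis
    by (rule LIMSEQ_le_const2) (use s(3) in auto)
qed

lemma continuous_on_eval_bcontfun: "continuous_on S (\<lambda>g :: 'a::topological_space \<Rightarrow>\<^sub>C 'b::real_normed_vector. apply_bcontfun g x)"
proof -
  have "bounded_linear (\<lambda>g :: 'a \<Rightarrow>\<^sub>C 'b. apply_bcontfun g x)"
    by (rule bounded_linear_intro[where K = 1]) (auto simp: norm_bounded)
  then show ?thesis by (rule linear_continuous_on)
qed

text \<open>Ekeland's principle is applied to the equivariant bounded continuous perturbations \<open>g\<close> of the identity, with the
  functional \<open>\<Psi> g = max {J (x + g x) | x \<in> A}\<close>. The image of \<open>A\<close> under \<open>x \<mapsto> x + g x\<close> stays in the index class, so
  \<open>\<Psi>\<close> is bounded below by the minimax level. At the \<open>g\<close> given by the principle a step against the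
  gradient cannot decrease \<open>\<Psi>\<close> at a rate above \<open>\<kappa>\<close>, which bounds the gradient at some point where the
  maximum is attained.

  Since \<open>\<parallel>g\<parallel> \<le> \<kappa>\<close>, the almost critical point lies close to \<open>A\<close> itself. This localisation is what makes it
  possible to keep the point away from the critical set when \<open>A\<close> is away from it.\<close>

lemma minimax_almost_critical:
  fixes R :: "real \<Rightarrow> 'a::{real_inner,complete_space} \<Rightarrow> 'a"
  assumes R: "isometric_S1_rep R" and C1: "is_C1_with_derivative J J'"
    and inv: "invariant_functional R J"
    and level: "ereal c \<le> minimax_level R J j" and j: "0 < j"
    and A: "A \<in> index_class R j" and sup: "\<And>x. x \<in> A \<Longrightarrow> J x \<le> c + \<kappa>\<^sup>2"
    and kap: "0 < \<kappa>" "\<kappa> < 1"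
  shows "\<exists>x\<in>A. \<exists>z. dist x z \<le> \<kappa> \<and> c \<le> J z \<and> J z \<le> c + \<kappa>\<^sup>2 \<and> (norm (J' z))\<^sup>2 \<le> \<kappa>"
proof -
  have deriv: "\<And>x. (J has_derivative blinfun_apply (J' x)) (at x)" and contJ': "continuous_on UNIV J'"
    using C1 by (auto simp: is_C1_with_derivative_def)
  have contJ: "continuous_on UNIV J"
    using deriv by (intro has_derivative_continuous_on[of UNIV J "\<lambda>x. blinfun_apply (J' x)"]) auto
  have "compact A" and "A \<noteq> {}" using A index_class_nonempty[OF j A] by (auto simp: index_class_def)
  define E :: "('a \<Rightarrow>\<^sub>C 'a) set" where "E = {g. \<forall>\<theta> x. apply_bcontfun g (R \<theta> x) = R \<theta> (apply_bcontfun g x)}"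
  have "closed E"
    unfolding E_def
    by (intro closed_Collect_all closed_Collect_eq continuous_on_eval_bcontfun
        continuous_on_rep[OF R] continuous_on_const)
  have "0 \<in> E"
    using linear_0[OF bounded_linear.linear[OF rep_bounded_linear[OF R]]] by (simp add: E_def)
  define \<Psi> where "\<Psi> g = (SUP x\<in>A. J (x + apply_bcontfun g x))" for g :: "'a \<Rightarrow>\<^sub>C 'a"
  have cont_fJ: "continuous_on A (\<lambda>x. J (x + apply_bcontfun g x))" for g :: "'a \<Rightarrow>\<^sub>C 'a"
    by (intro continuous_on_compose2[OF contJ] continuous_intros) auto
  have max: "\<exists>x\<in>A. J (x + apply_bcontfun g x) = \<Psi> g \<and> (\<forall>y\<in>A. J (y + apply_bcontfun g y) \<le> \<Psi> g)" for g
  proof -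
    obtain x where x: "x \<in> A" "\<And>y. y \<in> A \<Longrightarrow> J (y + apply_bcontfun g y) \<le> J (x + apply_bcontfun g x)"
      using continuous_attains_sup[OF \<open>compact A\<close> \<open>A \<noteq> {}\<close> cont_fJ[of g]] by blast
    then have "\<Psi> g = J (x + apply_bcontfun g x)"
      unfolding \<Psi>_def by (intro cSup_eq_maximum) auto
    then show ?thesis using x by auto
  qed
  have below: "c \<le> \<Psi> g" if "g \<in> E" for g
  proof -
    define f where "f x = x + apply_bcontfun g x" for x
    have "f (R \<theta> x) = R \<theta> (f x)" for \<theta> x
      using that linear_add[OF bounded_linear.linear[OF rep_bounded_linear[OF R]]]
      by (simp add: f_def E_def)
    moreover have "continuous_on A f" unfolding f_def by (intro continuous_intros) auto
    ultimately have "f ` A \<in> index_class R j" by (intro index_class_image[OF R A])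
    then have "minimax_level R J j \<le> (SUP x\<in>f ` A. ereal (J x))"
      unfolding minimax_level_def by (rule INF_lower)
    also have "\<dots> \<le> ereal (\<Psi> g)" using max[of g] by (intro SUP_least) (auto simp: f_def)
    finally show ?thesis using level by (metis ereal_less_eq(3) order_trans)
  qed
  have lsc: "eventually (\<lambda>g'. a < \<Psi> g') (nhds g)" if a: "a < \<Psi> g" for g a
  proof -
    obtain x where x: "x \<in> A" "a < J (x + apply_bcontfun g x)" using max[of g] a by metis
    have "continuous_on UNIV (\<lambda>g'. J (x + apply_bcontfun g' x))"
      by (intro continuous_on_compose2[OF contJ] continuous_intros continuous_on_eval_bcontfun) auto
    then have "((\<lambda>g'. J (x + apply_bcontfun g' x)) \<longlongrightarrow> J (x + apply_bcontfun g x)) (nhds g)"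
      by (simp add: continuous_on_def tendsto_nhds_iff)
    from order_tendstoD(1)[OF this x(2)] show ?thesis
    proof eventually_elim
      case (elim g') then show ?case using max[of g'] x(1) by force
    qed
  qed
  obtain g where g: "g \<in> E" "\<Psi> g + \<kappa> * dist 0 g \<le> \<Psi> 0"
    and opt: "\<And>g'. g' \<in> E \<Longrightarrow> \<Psi> g \<le> \<Psi> g' + \<kappa> * dist g g'"
    using ekeland_variational_principle[OF \<open>closed E\<close> \<open>0 \<in> E\<close> kap(1) below lsc] by metis
  have "\<Psi> 0 \<le> c + \<kappa>\<^sup>2" using max[of 0] sup by force
  moreover have "0 \<le> \<kappa> * norm g" using kap(1) by simp
  ultimately have "\<kappa> * norm g \<le> \<kappa> * \<kappa>" and \<Psi>_le: "\<Psi> g \<le> c + \<kappa>\<^sup>2"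
    using g(2) below[OF g(1)] by (simp_all add: power2_eq_square)
  then have norm_g: "norm g \<le> \<kappa>" using kap(1) by simp
  define f where "f x = x + apply_bcontfun g x" for x
  have f_eqv: "f (R \<theta> x) = R \<theta> (f x)" for \<theta> x
    using g(1) linear_add[OF bounded_linear.linear[OF rep_bounded_linear[OF R]]]
    by (simp add: f_def E_def)
  have f_cont: "continuous_on S f" for S unfolding f_def by (intro continuous_intros) auto
  \<comment> \<open>steps are taken along - V; truncation at length 1 makes the field bounded and keeps it equivariant\<close>
  define V where "V z = (1 / max 1 (norm (grad J' z))) *\<^sub>R grad J' z" for z
  have V_norm: "norm (V z) \<le> 1" for z by (simp add: V_def divide_simps)
  have V_eqv: "V (R \<theta> z) = R \<theta> (V z)" for \<theta> z
    using linear_scale[OF bounded_linear.linear[OF rep_bounded_linear[OF R]]]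
    by (simp add: V_def grad_equivariant[OF R inv deriv] rep_norm[OF R])
  have V_cont: "continuous_on UNIV V"
    unfolding V_def grad_def by (intro continuous_intros contJ') auto
  have Vf_cont: "continuous_on UNIV (\<lambda>x. V (f x))"
    by (rule continuous_on_compose2[OF V_cont f_cont]) auto
  define W where "W = Bcontfun (\<lambda>x. V (f x))"
  have W: "apply_bcontfun W x = V (f x)" for x
    unfolding W_def by (subst Bcontfun_inverse[OF bcontfun_normI[OF Vf_cont V_norm]]) simp
  have W_norm: "norm W \<le> 1" by (rule norm_bound) (simp add: W V_norm)
  have "g - t *\<^sub>R W \<in> E" for t
    using g(1) linear_diff[OF bounded_linear.linear[OF rep_bounded_linear[OF R]]]
      linear_scale[OF bounded_linear.linear[OF rep_bounded_linear[OF R]]]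
    by (simp add: E_def W f_eqv V_eqv)
  then have step: "\<Psi> g - \<kappa> * t \<le> \<Psi> (g - t *\<^sub>R W)" if "t > 0" for t
  proof -
    have "\<kappa> * dist g (g - t *\<^sub>R W) \<le> \<kappa> * (t * 1)"
      using W_norm kap that by (intro mult_left_mono) (auto simp: dist_norm)
    then show ?thesis using opt[OF \<open>g - t *\<^sub>R W \<in> E\<close>] by simp
  qed
  \<comment> \<open>perturbing by steps t n that tend to 0 yields maximum points x n; f maps a limit x0 of
      them to a maximum point of J on the image of A at which the decrease is too slow\<close>
  define t where "t n = inverse (real (Suc n))" for n
  have t: "t n > 0" for n by (simp add: t_def)
  have t_lim: "t \<longlonglongrightarrow> 0" unfolding t_def by (rule LIMSEQ_inverse_real_of_nat)
  obtain x where x: "x n \<in> A" "J (f (x n) - t n *\<^sub>R V (f (x n))) = \<Psi> (g - t n *\<^sub>R W)" for n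
    using max[of "g - t _ *\<^sub>R W"] by (simp add: W f_def algebra_simps) metis
  obtain x0 r where x0: "x0 \<in> A" and r: "strict_mono r" and x_lim: "(x \<circ> r) \<longlonglongrightarrow> x0"
    using \<open>compact A\<close> x(1) unfolding compact_def by metis
  define z where "z n = f (x (r n))" for n
  have z_lim: "z \<longlonglongrightarrow> f x0"
    using continuous_on_tendsto_compose[OF f_cont[of UNIV] x_lim] by (simp add: z_def[abs_def] o_def)
  have Vz_lim: "(\<lambda>n. V (z n)) \<longlonglongrightarrow> V (f x0)"
    using continuous_on_tendsto_compose[OF V_cont z_lim] by simp
  have tr_lim: "(\<lambda>n. t (r n)) \<longlonglongrightarrow> 0"
    using LIMSEQ_subseq_LIMSEQ[OF t_lim r] by (simp add: o_def)
  have z_step: "\<Psi> g - \<kappa> * t (r n) \<le> J (z n - t (r n) *\<^sub>R V (z n))" for n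
    using step[OF t[of "r n"]] x(2)[of "r n"] by (simp add: z_def)
  have "J (z n) - \<kappa> * t (r n) \<le> J (z n - t (r n) *\<^sub>R V (z n))" for n
  proof -
    have "J (z n) \<le> \<Psi> g" using max[of g] x(1)[of "r n"] by (auto simp: z_def f_def)
    then show ?thesis using z_step[of n] by linarith
  qed
  from derivative_le_of_difference_quotients[OF deriv contJ' z_lim Vz_lim tr_lim t this]
  have slope: "blinfun_apply (J' (f x0)) (V (f x0)) \<le> \<kappa>" .
  have "(\<lambda>n. J (z n - t (r n) *\<^sub>R V (z n))) \<longlonglongrightarrow> J (f x0 - 0 *\<^sub>R V (f x0))"
    by (intro continuous_on_tendsto_compose[OF contJ] tendsto_intros z_lim Vz_lim tr_lim) auto
  moreover have "(\<lambda>n. \<Psi> g - \<kappa> * t (r n)) \<longlonglongrightarrow> \<Psi> g - \<kappa> * 0"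
    by (intro tendsto_intros tr_lim)
  ultimately have "\<Psi> g \<le> J (f x0)"
    using LIMSEQ_le[of "\<lambda>n. \<Psi> g - \<kappa> * t (r n)" "\<Psi> g" _ "J (f x0)"] z_step by auto
  moreover have "J (f x0) \<le> \<Psi> g" using max[of g] x0 by (auto simp: f_def)
  moreover have "dist x0 (f x0) \<le> \<kappa>"
    using norm_bounded[of g x0] norm_g by (simp add: f_def dist_norm)
  moreover have "(norm (J' (f x0)))\<^sup>2 \<le> \<kappa>"
  proof -
    define N where "N = norm (grad J' (f x0))"
    have N_eq: "N = norm (J' (f x0))" by (simp add: N_def grad_def norm_riesz)
    have "blinfun_apply (J' (f x0)) (V (f x0)) = N\<^sup>2 / max 1 N"
      unfolding V_def N_def grad_def inner_riesz[symmetric] by (simp add: power2_norm_eq_inner)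
    then have s: "N\<^sup>2 / max 1 N \<le> \<kappa>" using slope by simp
    show ?thesis
    proof (cases "N \<le> 1")
      case True then show ?thesis using s by (simp add: N_eq)
    next
      case False
      then have "N \<le> \<kappa>" using s by (simp add: power2_eq_square max_def)
      then show ?thesis using False kap by simp
    qed
  qed
  ultimately show ?thesis using below[OF g(1)] \<Psi>_le x0 by (meson order_trans)
qed

section \<open>Equivariant functions that do not vanish on finitely many orbits\<close>

lemma isotropy_of_int_mult:
  assumes L: "isometric_S1_rep L" and g: "L g y = y"
  shows "L (of_int k * g) y = y"
proof -
  have nat: "L (of_nat m * g) y = y" for m :: nat
    by (induction m) (use g rep_zero[OF L] in \<open>auto simp: distrib_right rep_add[OF L]\<close>)
  show ?thesis
  proof (cases k)
    case (nonneg m) then show ?thesis using nat by simp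
  next
    case (neg m)
    have "L (- (of_nat (Suc m) * g)) (L (of_nat (Suc m) * g) y) = y" by (rule rep_inverse(1)[OF L])
    moreover have "of_int k * g = - (of_nat (Suc m) * g)" by (simp only: neg of_int_minus of_int_of_nat_eq mult_minus_left)
    ultimately show ?thesis using nat[of "Suc m"] by metis
  qed
qed

lemma isotropy_diff:
  assumes L: "isometric_S1_rep L" and "L g y = y" "L h y = y"
  shows "L (g - h) y = y"
  using rep_add[OF L, of g "- h" y] isotropy_of_int_mult[OF L assms(3), of "-1"] assms(2) by simp

text \<open>The isotropy group of a point that is not fixed is a closed proper subgroup of the real line, hence generated
  by a smallest positive element \<open>t\<close>; it contains \<open>2 * pi\<close>, so \<open>2 * pi = n * t\<close> for some \<open>n\<close>.
  For this \<open>n\<close> the character \<open>\<theta> \<mapsto> exp (\<i> * n * \<theta>)\<close> is trivial on the isotropy group, so a function of weight \<open>n\<close>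
  is not forced to vanish on the orbit.\<close>

lemma isotropy_cyclic:
  fixes L :: "real \<Rightarrow> 'a::real_normed_vector \<Rightarrow> 'a"
  assumes L: "isometric_S1_rep L" and y: "y \<notin> Fix_S1 L"
  shows "\<exists>n::nat. 1 \<le> n \<and> (\<forall>\<theta>. L \<theta> y = y \<longrightarrow> (\<exists>m::int. of_nat n * \<theta> = of_int m * (2 * pi)))"
proof -
  define G where "G = {\<theta>. L \<theta> y = y}"
  have G_mult: "of_int k * g \<in> G" if "g \<in> G" for k g
    using isotropy_of_int_mult[OF L] that by (simp add: G_def)
  have G_diff: "g - h \<in> G" if "g \<in> G" "h \<in> G" for g h
    using isotropy_diff[OF L] that by (simp add: G_def)
  have closed: "closed G"
    unfolding G_def by (intro closed_Collect_eq continuous_on_rep[OF L] continuous_intros)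
  have "2 * pi \<in> G" using rep_period[OF L, of 0] rep_zero[OF L] by (simp add: G_def)
  obtain \<theta>0 where "\<theta>0 \<in> - G" using y by (auto simp: Fix_S1_def G_def)
  then obtain \<delta> where \<delta>: "0 < \<delta>" "ball \<theta>0 \<delta> \<subseteq> - G"
    using closed open_contains_ball[of "- G"] by (auto simp: open_closed)
  have gap: "\<delta> \<le> g" if g: "g \<in> G" "0 < g" for g
  proof (rule ccontr)
    assume less: "\<not> \<delta> \<le> g"
    \<comment> \<open>some multiple of g lies within g of \<open>\<theta>0\<close>, hence within \<open>\<delta>\<close>, where G has no points\<close>
    have "of_int \<lfloor>\<theta>0 / g\<rfloor> * g \<le> \<theta>0"
      by (rule floor_divide_lower[OF g(2)])
    moreover have "\<theta>0 < (of_int \<lfloor>\<theta>0 / g\<rfloor> + 1) * g"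
      by (rule floor_divide_upper[OF g(2)])
    ultimately have "of_int \<lfloor>\<theta>0 / g\<rfloor> * g \<in> ball \<theta>0 \<delta>"
      using less by (auto simp: dist_real_def algebra_simps)
    then show False using \<delta>(2) G_mult[OF g(1)] by blast
  qed
  define P where "P = G \<inter> {\<delta>..}"
  define t where "t = Inf P"
  have bdd: "bdd_below P" by (auto simp: P_def intro: bdd_belowI[of _ \<delta>])
  have "2 * pi \<in> P" using \<open>2 * pi \<in> G\<close> gap[of "2 * pi"] by (simp add: P_def)
  then have "t \<in> P"
    unfolding t_def using bdd closed by (intro closed_contains_Inf) (auto simp: P_def)
  then have t: "t \<in> G" "0 < t" using \<delta>(1) by (auto simp: P_def)
  have multiple: "\<exists>m::int. g = of_int m * t" if g: "g \<in> G" for g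
  proof (rule ccontr)
    assume none: "\<not> ?thesis"
    define h where "h = g - of_int \<lfloor>g / t\<rfloor> * t"
    have "h \<in> G" unfolding h_def using G_diff[OF g G_mult[OF t(1)]] .
    moreover have "0 \<le> h"
      using floor_divide_lower[OF t(2), of g] by (simp add: h_def)
    moreover have "h \<noteq> 0" using none by (auto simp: h_def)
    ultimately have "h \<in> P" using gap[of h] by (simp add: P_def)
    then have "t \<le> h" unfolding t_def using bdd by (rule cInf_lower)
    moreover have "h < t"
      using floor_divide_upper[OF t(2), of g] by (simp add: h_def algebra_simps)
    ultimately show False by simp
  qed
  obtain m where m: "2 * pi = of_int m * t" using multiple[OF \<open>2 * pi \<in> G\<close>] by blast
  then have "0 < of_int m * t" using pi_gt_zero by linarith
  then have "0 < m" using t(2) by (simp add: zero_less_mult_iff)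
  show ?thesis
  proof (intro exI[of _ "nat m"] conjI allI impI)
    fix \<theta> assume "L \<theta> y = y"
    then obtain k where "\<theta> = of_int k * t" using multiple by (auto simp: G_def)
    then have "of_nat (nat m) * \<theta> = of_int k * (2 * pi)"
      using m \<open>0 < m\<close> by simp
    then show "\<exists>k. of_nat (nat m) * \<theta> = of_int k * (2 * pi)" by blast
  qed (use \<open>0 < m\<close> in auto)
qed

text \<open>The product of the individual weights serves all points of a finite set at once.\<close>

lemma common_isotropy_weight:
  fixes L :: "real \<Rightarrow> 'a::real_normed_vector \<Rightarrow> 'a"
  assumes L: "isometric_S1_rep L" and "finite F" "F \<inter> Fix_S1 L = {}"
  shows "\<exists>n::nat. 1 \<le> n \<and> (\<forall>y\<in>F. \<forall>\<theta>. L \<theta> y = y \<longrightarrow> (\<exists>m::int. of_nat n * \<theta> = of_int m * (2 * pi)))"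
  using assms(2,3)
proof (induction F)
  case empty then show ?case by (intro exI[of _ 1]) auto
next
  case (insert y F)
  obtain n where n: "1 \<le> n" "\<forall>y\<in>F. \<forall>\<theta>. L \<theta> y = y \<longrightarrow> (\<exists>m::int. of_nat n * \<theta> = of_int m * (2 * pi))"
    using insert.IH insert.prems by (metis Int_insert_left_if0 Int_insert_left_if1 insert_not_empty)
  obtain k where k: "1 \<le> k" "\<forall>\<theta>. L \<theta> y = y \<longrightarrow> (\<exists>m::int. of_nat k * \<theta> = of_int m * (2 * pi))"
    using isotropy_cyclic[OF L, of y] insert.prems by (metis Int_insert_left_if1 insert_not_empty)
  have mult: "\<exists>m::int. of_nat (a * b) * \<theta> = of_int m * (2 * pi)"
    if "of_nat a * \<theta> = of_int m * (2 * pi)" for a b :: nat and m :: int and \<theta> :: real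
  proof -
    have "of_nat (a * b) * \<theta> = of_nat b * (of_nat a * \<theta>)" by simp
    also have "\<dots> = of_int (int b * m) * (2 * pi)" unfolding that by simp
    finally show ?thesis by blast
  qed
  show ?case
  proof (intro exI[of _ "n * k"] conjI ballI allI impI)
    show "1 \<le> n * k" using n(1) k(1) by simp
    fix z \<theta> assume z: "z \<in> insert y F" "L \<theta> z = z"
    show "\<exists>m::int. of_nat (n * k) * \<theta> = of_int m * (2 * pi)"
    proof (cases "z = y")
      case True
      then obtain m :: int where "of_nat k * \<theta> = of_int m * (2 * pi)" using k(2) z(2) by blast
      from mult[OF this, of n] show ?thesis by (simp only: mult.commute)
    next
      case False
      then obtain m :: int where "of_nat n * \<theta> = of_int m * (2 * pi)" using n(2) z by blast
      from mult[OF this, of k] show ?thesis .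
    qed
  qed
qed

lemma integral_periodic_shift:
  fixes p :: "real \<Rightarrow> 'a::banach"
  assumes cont: "continuous_on UNIV p" and per: "\<And>x. p (x + T) = p x" and T: "0 \<le> T"
  shows "integral {0..T} (\<lambda>x. p (x + s)) = integral {0..T} p"
proof -
  have pos: "integral {0..T} (\<lambda>x. q (x + s)) = integral {0..T} q"
    if "0 \<le> s" and q: "continuous_on UNIV q" "\<And>x. q (x + T) = q x" for s and q :: "real \<Rightarrow> 'a"
  proof -
    have int: "q integrable_on {a..b}" for a b
      using q(1) by (intro integrable_continuous_interval) (auto intro: continuous_on_subset)
    have "integral {0..T} (\<lambda>x. q (x + s)) = integral {s..s + T} q"
      using integral_shift_real_ivl[of s s "s + T" q] by simp
    moreover have "integral {T..s + T} q = integral {0..s} q"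
      using integral_shift_real_ivl[of T T "s + T" q] q(2) by simp
    moreover have "integral {0..s} q + integral {s..s + T} q = integral {0..s + T} q"
      "integral {0..T} q + integral {T..s + T} q = integral {0..s + T} q"
      using Henstock_Kurzweil_Integration.integral_combine[OF _ _ int] \<open>0 \<le> s\<close> T by auto
    ultimately show ?thesis by (metis add.commute add_right_cancel)
  qed
  show ?thesis
  proof (cases "0 \<le> s")
    case True then show ?thesis using pos cont per by blast
  next
    case False
    have "p (x + T + s) = p (x + s)" for x using per[of "x + s"] by (simp add: ac_simps)
    then have "integral {0..T} (\<lambda>x. p (x + - s + s)) = integral {0..T} (\<lambda>x. p (x + s))"
      using False
      by (intro pos[of "- s" "\<lambda>x. p (x + s)"])
         (auto intro!: continuous_on_compose2[OF cont] continuous_intros)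
    then show ?thesis by simp
  qed
qed

text \<open>Averaging any continuous function \<open>h\<close> against the character of weight \<open>n\<close> gives an equivariant function
  \<open>\<psi>\<close>. To keep the average from vanishing at \<open>y \<in> F\<close>, \<open>h\<close> is taken to be the distance to the set \<open>C\<close> of all
  \<open>L \<theta> y\<close> with \<open>cos (n * \<theta>) \<le> 0\<close>: then the integrand has nonnegative real part everywhere. The real part is positive at
  \<open>\<theta> = 0\<close>, because \<open>C\<close> misses \<open>F\<close>: a point of \<open>F\<close> in \<open>C\<close> would be \<open>L \<theta> y\<close> with \<open>\<theta>\<close> in the isotropy group of
  \<open>y\<close>, where \<open>cos (n * \<theta>) = 1\<close>. Here the points of \<open>F\<close> must represent distinct orbits.\<close>

lemma equivariant_function_on_finite_orbits:
  fixes L :: "real \<Rightarrow> 'a::real_normed_vector \<Rightarrow> 'a"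
  assumes L: "isometric_S1_rep L" and F: "finite F" "F \<inter> Fix_S1 L = {}"
    and distinct: "\<forall>y\<in>F. \<forall>y'\<in>F. \<forall>\<theta>. L \<theta> y = y' \<longrightarrow> y = y'"
  shows "\<exists>(n::nat) (\<psi> :: 'a \<Rightarrow> complex). 1 \<le> n \<and> continuous_on UNIV \<psi> \<and>
    (\<forall>\<theta> y. \<psi> (L \<theta> y) = exp (\<i> * of_nat n * of_real \<theta>) * \<psi> y) \<and> (\<forall>y\<in>F. \<psi> y \<noteq> 0)"
proof -
  obtain n :: nat where n: "1 \<le> n"
    and isotropy: "\<And>y \<theta>. y \<in> F \<Longrightarrow> L \<theta> y = y \<Longrightarrow> \<exists>m::int. of_nat n * \<theta> = of_int m * (2 * pi)"
    using common_isotropy_weight[OF L F] by blast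
  define I where "I = {\<theta>\<in>{0..2 * pi}. cos (of_nat n * \<theta>) \<le> 0}"
  have "compact I"
  proof -
    have "closed {\<theta>::real. cos (of_nat n * \<theta>) \<le> 0}"
      by (intro closed_Collect_le continuous_intros)
    then have "compact ({0..2 * pi} \<inter> {\<theta>. cos (of_nat n * \<theta>) \<le> 0})"
      by (intro compact_Int_closed) auto
    moreover have "I = {0..2 * pi} \<inter> {\<theta>. cos (of_nat n * \<theta>) \<le> 0}" by (auto simp: I_def)
    ultimately show ?thesis by simp
  qed
  define C where "C = (\<Union>y\<in>F. (\<lambda>\<theta>. L \<theta> y) ` I)"
  have "closed C"
    unfolding C_def using F(1) \<open>compact I\<close>
    by (intro compact_imp_closed compact_UN compact_continuous_image continuous_on_rep[OF L] continuous_intros)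
  have "pi / n \<in> I" using n by (auto simp: I_def field_simps)
  have off_C: "y \<notin> C" if "y \<in> F" for y
  proof
    assume "y \<in> C"
    then obtain y' \<theta> where y': "y' \<in> F" "\<theta> \<in> I" "y = L \<theta> y'" by (auto simp: C_def)
    then have "L \<theta> y' = y'" using distinct y'(1) that by metis
    then obtain m :: int where "of_nat n * \<theta> = of_int m * (2 * pi)" using isotropy[OF y'(1)] by blast
    then have "cos (of_nat n * \<theta>) = 1"
      using cos_int_2pin[of m] by (simp only: mult.commute)
    then show False using y'(2) by (simp add: I_def)
  qed
  define h where "h y = infdist y C" for y
  define p where "p y \<theta> = exp (- (\<i> * of_nat n * of_real \<theta>)) * of_real (h (L \<theta> y))" for y \<theta>
  define \<psi> where "\<psi> y = integral {0..2 * pi} (p y)" for y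
  have p_cont: "continuous_on S (\<lambda>q. p (fst q) (snd q))" for S
    unfolding p_def h_def by (intro continuous_intros continuous_on_rep[OF L])
  have p_cont1: "continuous_on S (p y)" for S y
    unfolding p_def h_def by (intro continuous_intros continuous_on_rep[OF L])
  have "continuous_on UNIV \<psi>"
    unfolding \<psi>_def using integral_continuous_on_param[of UNIV 0 "2 * pi" p] p_cont
    by (simp add: case_prod_beta)
  moreover have "\<psi> (L s y) = exp (\<i> * of_nat n * of_real s) * \<psi> y" for s y
  proof -
    have shift: "p (L s y) \<theta> = exp (\<i> * of_nat n * of_real s) * p y (\<theta> + s)" for \<theta>
    proof -
      have "exp (- (\<i> * of_nat n * of_real \<theta>))
          = exp (\<i> * of_nat n * of_real s) * exp (- (\<i> * of_nat n * of_real (\<theta> + s)))"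
        unfolding exp_add[symmetric] by (simp add: algebra_simps)
      then show ?thesis by (simp add: p_def rep_add[OF L])
    qed
    have "p y (\<theta> + 2 * pi) = p y \<theta>" for \<theta>
    proof -
      have "- (\<i> * of_nat n * of_real (\<theta> + 2 * pi)) = - (\<i> * of_nat n * of_real \<theta>) + \<i> * (of_int (- int n) * (of_real pi * 2))"
        by (simp add: algebra_simps)
      then have "exp (- (\<i> * of_nat n * of_real (\<theta> + 2 * pi))) = exp (- (\<i> * of_nat n * of_real \<theta>))"
        using exp_plus_2pin by metis
      then show ?thesis by (simp only: p_def rep_period[OF L])
    qed
    then have "integral {0..2 * pi} (\<lambda>\<theta>. p y (\<theta> + s)) = \<psi> y"
      unfolding \<psi>_def by (intro integral_periodic_shift p_cont1) auto
    then show ?thesis unfolding \<psi>_def[of "L s y"] shift by simp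
  qed
  moreover have "\<psi> y \<noteq> 0" if y: "y \<in> F" for y
  proof
    assume zero: "\<psi> y = 0"
    have Re_p: "Re (p y \<theta>) = cos (of_nat n * \<theta>) * h (L \<theta> y)" for \<theta>
      by (simp add: p_def exp_eq_polar Re_exp)
    have "integral {0..2 * pi} (Re \<circ> p y) = Re (\<psi> y)"
      unfolding \<psi>_def by (intro integral_linear integrable_continuous_real p_cont1 bounded_linear_Re)
    moreover have "0 \<le> (Re \<circ> p y) \<theta>" if \<theta>: "\<theta> \<in> {0..2 * pi}" for \<theta>
    proof (cases "\<theta> \<in> I")
      case True
      then have "L \<theta> y \<in> C" using y by (auto simp: C_def)
      then show ?thesis by (simp add: Re_p h_def)
    next
      case False
      then show ?thesis using \<theta> by (simp add: Re_p h_def I_def infdist_nonneg)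
    qed
    moreover have "continuous_on {0..2 * pi} (Re \<circ> p y)"
      by (intro continuous_on_compose p_cont1 continuous_intros)
    ultimately have "\<forall>\<theta>\<in>{0..2 * pi}. (Re \<circ> p y) \<theta> = 0"
      using zero integral_eq_0_iff[of 0 "2 * pi" "Re \<circ> p y"] by simp
    then have "(Re \<circ> p y) 0 = 0" by simp
    then have "infdist y C = 0" by (simp add: Re_p h_def rep_zero[OF L])
    moreover have "C \<noteq> {}" using y \<open>pi / n \<in> I\<close> by (auto simp: C_def)
    ultimately show False
      using off_C[OF y] in_closed_iff_infdist_zero[OF \<open>closed C\<close>] by blast
  qed
  ultimately show ?thesis using n by blast
qed

section \<open>Orbits and excision\<close>

lemma orbit_S1_eq:
  assumes L: "isometric_S1_rep L" and "z \<in> orbit_S1 L y"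
  shows "orbit_S1 L z = orbit_S1 L y"
proof -
  obtain \<alpha> where z: "z = L \<alpha> y" using assms(2) by (auto simp: orbit_S1_def)
  have "L \<theta> z = L (\<theta> + \<alpha>) y" "L \<theta> y = L (\<theta> - \<alpha>) z" for \<theta>
    using rep_add[OF L, of \<theta> \<alpha> y] rep_add[OF L, of "\<theta> - \<alpha>" \<alpha> y] by (simp_all add: z)
  then show ?thesis unfolding orbit_S1_def by blast
qed

lemma orbit_S1_self: "isometric_S1_rep L \<Longrightarrow> y \<in> orbit_S1 L y"
  using rep_zero[of L y] by (auto simp: orbit_S1_def intro: exI[of _ 0])

lemma compact_orbit_S1:
  assumes L: "isometric_S1_rep L"
  shows "compact (orbit_S1 L y)"
proof -
  have "orbit_S1 L y = (\<lambda>\<theta>. L \<theta> y) ` {0..2 * pi}"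
  proof (intro equalityI subsetI)
    fix z assume "z \<in> orbit_S1 L y"
    then obtain \<theta> where z: "z = L \<theta> y" by (auto simp: orbit_S1_def)
    define k where "k = \<lfloor>\<theta> / (2 * pi)\<rfloor>"
    have "L (2 * pi) y = y" using rep_period[OF L, of 0] rep_zero[OF L] by simp
    then have "L (\<theta> - of_int k * (2 * pi)) y = z"
      using rep_add[OF L, of "\<theta> - of_int k * (2 * pi)" "of_int k * (2 * pi)" y]
        isotropy_of_int_mult[OF L] z by simp
    moreover have "\<theta> - of_int k * (2 * pi) \<in> {0..2 * pi}"
      using floor_divide_lower[of "2 * pi" \<theta>] floor_divide_upper[of "2 * pi" \<theta>]
      by (simp add: k_def algebra_simps)
    ultimately show "z \<in> (\<lambda>\<theta>. L \<theta> y) ` {0..2 * pi}" by blast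
  qed (auto simp: orbit_S1_def)
  then show ?thesis
    by (simp add: compact_continuous_image continuous_on_rep[OF L] continuous_on_id continuous_on_const)
qed

lemma infdist_rep_invariant:
  assumes L: "isometric_S1_rep L" and K: "\<And>\<theta> y. y \<in> K \<Longrightarrow> L \<theta> y \<in> K"
  shows "infdist (L \<theta> y) K = infdist y K"
proof (cases "K = {}")
  case False
  have le: "infdist (L \<theta> y) K \<le> infdist y K" for \<theta> y
    unfolding infdist_notempty[OF False, of y]
  proof (rule cINF_greatest[OF False])
    fix a assume "a \<in> K"
    then show "infdist (L \<theta> y) K \<le> dist y a"
      using infdist_le[OF K] by (metis rep_dist[OF L])
  qed
  show ?thesis using le[of \<theta> y] le[of "- \<theta>" "L \<theta> y"] by (simp add: rep_inverse[OF L])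
qed (simp add: infdist_def)

text \<open>Subadditivity of the index in the form needed here: the removed part carries an equivariant function \<open>\<psi>\<close> without
  zeros and so has index at most one. A map \<open>\<Phi>\<close> on the remaining part extends by zero after multiplication with the
  invariant cutoff \<open>d x - r\<close>, and \<open>\<psi>\<close> is added as a last coordinate. Powers of the coordinates bring both maps to
  the common weight \<open>n * m\<close>.\<close>

lemma index_class_excision:
  fixes R :: "real \<Rightarrow> 'a::real_normed_vector \<Rightarrow> 'a" and d :: "'a \<Rightarrow> real"
  assumes R: "isometric_S1_rep R" and A: "A \<in> index_class R k" and "j < k"
    and d: "continuous_on UNIV d" "\<And>\<theta> x. d (R \<theta> x) = d x"
    and \<psi>: "continuous_on UNIV \<psi>" "1 \<le> m"
      "\<And>\<theta> x. \<psi> (R \<theta> x) = exp (\<i> * of_nat m * of_real \<theta>) * \<psi> x"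
    and nz: "\<And>x. x \<in> A \<Longrightarrow> d x \<le> r \<Longrightarrow> \<psi> x \<noteq> (0::complex)"
  shows "{x \<in> A. r \<le> d x} \<in> index_class R j"
proof -
  define B where "B = {x \<in> A. r \<le> d x}"
  have "compact A" and inv: "\<And>\<theta> x. x \<in> A \<Longrightarrow> R \<theta> x \<in> A"
    and ind: "\<And>k' n \<Phi>. 1 \<le> n \<Longrightarrow> equivariant_map R A k' n \<Phi> \<Longrightarrow> k \<le> k'"
    using A by (auto simp: index_class_def index_ge_iff intro: invariant_setD)
  have cl: "closed {x. r \<le> d x}"
    by (intro closed_Collect_le continuous_on_const d(1))
  have "B = A \<inter> {x. r \<le> d x}" by (auto simp: B_def)
  then have "compact B" using compact_Int_closed[OF \<open>compact A\<close> cl] by simp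
  have B_inv: "invariant_set R B"
    by (rule invariant_setI[OF R]) (auto simp: B_def inv d)
  have "j \<le> l" if n: "1 \<le> n" and eqv: "equivariant_map R B l n \<Phi>" for l n \<Phi>
  proof -
    define \<Phi>' where "\<Phi>' x i = (if i < l then (if d x \<le> r then 0 else of_real (d x - r) * \<Phi> x i ^ m) else \<psi> x ^ n)" for x i
    have "continuous_on A (\<lambda>x. \<Phi>' x i)" for i
    proof (cases "i < l")
      case True
      have "continuous_on A (\<lambda>x. if d x \<le> r then 0 else complex_of_real (d x - r) * \<Phi> x i ^ m)"
      proof (rule continuous_on_cases_le)
        show "continuous_on {x \<in> A. r \<le> d x} (\<lambda>x. complex_of_real (d x - r) * \<Phi> x i ^ m)"
          unfolding B_def[symmetric] using eqv True
          by (intro continuous_intros continuous_on_subset[OF d(1)]) (auto simp: equivariant_map_def)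
      qed (use d(1) continuous_on_subset in auto)
      then show ?thesis using True by (simp add: \<Phi>'_def)
    next
      case False
      then show ?thesis
        using continuous_on_power[OF continuous_on_subset[OF \<psi>(1)], of A n] by (simp add: \<Phi>'_def)
    qed
    moreover have "\<exists>i<Suc l. \<Phi>' x i \<noteq> 0" if x: "x \<in> A" for x
    proof (cases "d x \<le> r")
      case True
      then show ?thesis using nz[OF x] by (intro exI[of _ l]) (simp add: \<Phi>'_def)
    next
      case False
      then have "x \<in> B" using x by (simp add: B_def)
      then obtain i where "i < l" "\<Phi> x i \<noteq> 0" using eqv unfolding equivariant_map_def by blast
      then show ?thesis using False by (intro exI[of _ i]) (simp add: \<Phi>'_def)
    qed
    moreover have "\<Phi>' (R \<theta> x) i = exp (\<i> * of_nat (n * m) * of_real \<theta>) * \<Phi>' x i" if x: "x \<in> A" for \<theta> x i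
    proof -
      have pow: "exp (\<i> * of_nat n * of_real \<theta>) ^ m = exp (\<i> * of_nat (n * m) * of_real \<theta>)"
        "exp (\<i> * of_nat m * of_real \<theta>) ^ n = exp (\<i> * of_nat (n * m) * of_real \<theta>)"
        unfolding exp_of_nat_mult[symmetric] by (simp_all add: mult_ac)
      have "\<Phi> (R \<theta> x) i = exp (\<i> * of_nat n * of_real \<theta>) * \<Phi> x i" if "i < l" "r \<le> d x"
        using eqv x that by (auto simp: equivariant_map_def B_def)
      then show ?thesis
        by (simp add: \<Phi>'_def d(2) \<psi>(3) power_mult_distrib pow del: of_nat_mult)
    qed
    ultimately have "equivariant_map R A (Suc l) (n * m) \<Phi>'" by (auto simp: equivariant_map_def)
    then have "k \<le> Suc l" using ind[of "n * m"] n \<psi>(2) by auto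
    then show ?thesis using \<open>j < k\<close> by simp
  qed
  then have "enat j \<le> S1_index R B" by (simp add: index_ge_iff)
  then show ?thesis using \<open>compact B\<close> B_inv by (simp add: index_class_def B_def)
qed

lemma minimax_near_optimal_set:
  assumes "minimax_level R J j = ereal c" and "0 < e"
  shows "\<exists>A\<in>index_class R j. \<forall>x\<in>A. J x \<le> c + e"
proof -
  have "minimax_level R J j < ereal (c + e)" using assms by simp
  then obtain A where A: "A \<in> index_class R j" "(SUP x\<in>A. ereal (J x)) < ereal (c + e)"
    unfolding minimax_level_def INF_less_iff by blast
  have "J x \<le> c + e" if "x \<in> A" for x
    using A(2) SUP_upper[OF that, of "\<lambda>x. ereal (J x)"] by (metis ereal_less_eq(3) less_imp_le order_trans)
  then show ?thesis using A(1) by blast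
qed

section \<open>Existence and multiplicity of critical orbits\<close>

text \<open>The set \<open>S\<close> records where almost optimal sets can be found: the whole space for the existence of a critical point,
  the complement of a neighbourhood of the critical set for multiplicity.\<close>

lemma palais_smale_sequence_near:
  fixes R :: "real \<Rightarrow> 'a::{real_inner,complete_space} \<Rightarrow> 'a"
  assumes R: "isometric_S1_rep R" and C1: "is_C1_with_derivative J J'"
    and inv: "invariant_functional R J"
    and level: "ereal c \<le> minimax_level R J j" and j: "0 < j"
    and near: "\<And>e. 0 < e \<Longrightarrow> \<exists>A\<in>index_class R j. A \<subseteq> S \<and> (\<forall>x\<in>A. J x \<le> c + e)"
  shows "\<exists>x z. (\<forall>n::nat. x n \<in> S) \<and> (\<lambda>n. dist (x n) (z n)) \<longlonglongrightarrow> 0 \<and>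
    (\<lambda>n. J (z n)) \<longlonglongrightarrow> c \<and> (\<lambda>n. J' (z n)) \<longlonglongrightarrow> 0"
proof -
  define \<kappa> where "\<kappa> n = inverse (real (Suc (Suc n)))" for n
  have kap: "0 < \<kappa> n" "\<kappa> n < 1" for n by (simp_all add: \<kappa>_def inverse_less_1_iff)
  have kap_lim: "\<kappa> \<longlonglongrightarrow> 0"
    using LIMSEQ_Suc[OF LIMSEQ_inverse_real_of_nat] by (simp add: \<kappa>_def[abs_def])
  have "\<exists>x\<in>S. \<exists>z. dist x z \<le> \<kappa> n \<and> c \<le> J z \<and> J z \<le> c + (\<kappa> n)\<^sup>2 \<and> (norm (J' z))\<^sup>2 \<le> \<kappa> n" for n
  proof -
    obtain A where A: "A \<in> index_class R j" "A \<subseteq> S" "\<And>x. x \<in> A \<Longrightarrow> J x \<le> c + (\<kappa> n)\<^sup>2"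
      using near[of "(\<kappa> n)\<^sup>2"] kap[of n] by auto
    show ?thesis
      using minimax_almost_critical[OF R C1 inv level j A(1,3) kap] A(2) by blast
  qed
  then have "\<forall>n. \<exists>x z. x \<in> S \<and> dist x z \<le> \<kappa> n \<and> c \<le> J z \<and> J z \<le> c + (\<kappa> n)\<^sup>2 \<and> (norm (J' z))\<^sup>2 \<le> \<kappa> n"
    by blast
  then obtain x z where "\<forall>n. x n \<in> S \<and> dist (x n) (z n) \<le> \<kappa> n \<and> c \<le> J (z n) \<and> J (z n) \<le> c + (\<kappa> n)\<^sup>2
      \<and> (norm (J' (z n)))\<^sup>2 \<le> \<kappa> n" by metis
  then have xz: "\<And>n. x n \<in> S" "\<And>n. dist (x n) (z n) \<le> \<kappa> n" "\<And>n. c \<le> J (z n)"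
    "\<And>n. J (z n) \<le> c + (\<kappa> n)\<^sup>2" "\<And>n. (norm (J' (z n)))\<^sup>2 \<le> \<kappa> n" by blast+
  show ?thesis
  proof (rule exI[of _ x], rule exI[of _ z], intro conjI allI)
    show "(\<lambda>n. dist (x n) (z n)) \<longlonglongrightarrow> 0"
      by (rule tendsto_sandwich[OF _ _ tendsto_const kap_lim]) (simp_all add: xz(2))
    have "(\<lambda>n. c + (\<kappa> n)\<^sup>2) \<longlonglongrightarrow> c"
      using tendsto_add[OF tendsto_const tendsto_power[OF kap_lim, of 2], of c] by simp
    from tendsto_sandwich[OF _ _ tendsto_const this] show "(\<lambda>n. J (z n)) \<longlonglongrightarrow> c"
      by (simp add: xz(3,4))
    have "norm (J' (z n)) \<le> sqrt (\<kappa> n)" for n using xz(5) by (rule real_le_rsqrt)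
    moreover have "(\<lambda>n. sqrt (\<kappa> n)) \<longlonglongrightarrow> 0" using tendsto_real_sqrt[OF kap_lim] by simp
    ultimately show "(\<lambda>n. J' (z n)) \<longlonglongrightarrow> 0"
      by (intro Lim_null_comparison[of "\<lambda>n. J' (z n)" "\<lambda>n. sqrt (\<kappa> n)"]) simp_all
  qed (rule xz(1))
qed

lemma critical_set_nonempty:
  fixes \<iota> :: "'x::{real_inner,complete_space} \<Rightarrow> 'y::real_normed_vector"
  assumes R: "isometric_S1_rep R" and C1: "is_C1_with_derivative J J'"
    and inv: "invariant_functional R J"
    and j: "0 < j" and level: "minimax_level R J j = ereal c" and wPS: "wPS \<iota> J J' c"
  shows "critical_set J J' c \<noteq> {}"
proof -
  have near: "\<exists>A\<in>index_class R j. A \<subseteq> UNIV \<and> (\<forall>x\<in>A. J x \<le> c + e)" if e: "0 < e" for e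
    using minimax_near_optimal_set[OF level e] by blast
  obtain z where "(\<lambda>n. J (z n)) \<longlonglongrightarrow> c" "(\<lambda>n. J' (z n)) \<longlonglongrightarrow> 0"
    using palais_smale_sequence_near[OF R C1 inv eq_refl[OF level[symmetric]] j near] by blast
  then show ?thesis using wPS unfolding wPS_def critical_set_def by blast
qed

lemma restrict_rep_embed:
  assumes "L \<theta> ` range \<iota> = range \<iota>"
  shows "\<iota> (restrict_rep \<iota> L \<theta> x) = L \<theta> (\<iota> x)"
proof -
  have "L \<theta> (\<iota> x) \<in> range \<iota>" using assms by blast
  then show ?thesis by (simp add: restrict_rep_def f_inv_into_f)
qed

lemma critical_set_invariant:
  fixes R :: "real \<Rightarrow> 'a::{real_inner,complete_space} \<Rightarrow> 'a"
  assumes R: "isometric_S1_rep R" and C1: "is_C1_with_derivative J J'"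
    and inv: "invariant_functional R J" and q: "q \<in> critical_set J J' c"
  shows "R \<theta> q \<in> critical_set J J' c"
proof -
  have "J (R \<theta> q) = J q" using inv by (metis invariant_functional_def comp_apply)
  moreover have "norm (J' (R \<theta> q)) = norm (J' q)"
    using grad_equivariant[OF R inv, of J' \<theta> q] C1 rep_norm[OF R, of \<theta>]
    by (metis grad_def is_C1_with_derivative_def norm_riesz)
  ultimately show ?thesis using q by (simp add: critical_set_def)
qed

text \<open>With only finitely many critical orbits, the critical set has compact image \<open>K\<close> in the larger space, and a
  neighbourhood of \<open>K\<close> there carries an equivariant function without zeros. Excision of this neighbourhood from almost
  optimal sets for \<open>k\<close> leaves almost optimal sets for \<open>j\<close>, hence a Palais-Smale sequence that stays away from \<open>K\<close> in
  the norm of the larger space. This is exactly the norm in which \<open>wPS\<close> provides a limit in \<open>K\<close>.\<close>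

lemma infinitely_many_critical_orbits:
  fixes \<iota> :: "'x::{real_inner,complete_space} \<Rightarrow> 'y::real_normed_vector"
  assumes \<iota>: "bounded_linear \<iota>" "inj \<iota>" and L: "isometric_S1_rep L"
    and R: "isometric_S1_rep R" and embed: "\<And>\<theta> x. \<iota> (R \<theta> x) = L \<theta> (\<iota> x)"
    and C1: "is_C1_with_derivative J J'" and inv: "invariant_functional R J"
    and jk: "0 < j" "j < k"
    and levels: "minimax_level R J j = ereal c" "minimax_level R J k = ereal c"
    and wPS: "wPS \<iota> J J' c" and free: "\<iota> ` critical_set J J' c \<inter> Fix_S1 L = {}"
  shows "infinite (orbit_S1 R ` critical_set J J' c)"
proof
  assume fin: "finite (orbit_S1 R ` critical_set J J' c)"
  define Kc where "Kc = critical_set J J' c"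
  have Kc_inv: "R \<theta> q \<in> Kc" if "q \<in> Kc" for \<theta> q
    using critical_set_invariant[OF R C1 inv] that by (simp add: Kc_def)
  \<comment> \<open>one representative for each critical orbit\<close>
  obtain rep where rep: "\<And>q. q \<in> Kc \<Longrightarrow> rep (orbit_S1 R q) \<in> Kc"
    "\<And>q. q \<in> Kc \<Longrightarrow> orbit_S1 R (rep (orbit_S1 R q)) = orbit_S1 R q"
  proof (rule that[of "\<lambda>orb. SOME q. q \<in> Kc \<and> orbit_S1 R q = orb"])
    fix q assume "q \<in> Kc"
    then have "\<exists>q'. q' \<in> Kc \<and> orbit_S1 R q' = orbit_S1 R q" by blast
    from someI_ex[OF this] show "(SOME q'. q' \<in> Kc \<and> orbit_S1 R q' = orbit_S1 R q) \<in> Kc"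
      "orbit_S1 R (SOME q'. q' \<in> Kc \<and> orbit_S1 R q' = orbit_S1 R q) = orbit_S1 R q" by auto
  qed
  define F0 where "F0 = rep ` orbit_S1 R ` Kc"
  have F0: "finite F0" "F0 \<subseteq> Kc" using fin rep(1) by (auto simp: F0_def Kc_def)
  have F0_unique: "q = q'" if "q \<in> F0" "q' \<in> F0" "R \<theta> q = q'" for q q' \<theta>
  proof -
    have "q' \<in> orbit_S1 R q" using that(3) by (auto simp: orbit_S1_def)
    then have "orbit_S1 R q' = orbit_S1 R q" by (rule orbit_S1_eq[OF R])
    moreover have "rep (orbit_S1 R q) = q" "rep (orbit_S1 R q') = q'"
      using that(1,2) rep(2) by (auto simp: F0_def)
    ultimately show ?thesis by metis
  qed
  define F where "F = \<iota> ` F0"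
  have F_unique: "\<forall>y\<in>F. \<forall>y'\<in>F. \<forall>\<theta>. L \<theta> y = y' \<longrightarrow> y = y'"
  proof (intro ballI allI impI)
    fix y y' \<theta> assume y: "y \<in> F" "y' \<in> F" "L \<theta> y = y'"
    obtain q q' where q: "q \<in> F0" "y = \<iota> q" "q' \<in> F0" "y' = \<iota> q'" using y by (auto simp: F_def)
    then have "\<iota> (R \<theta> q) = \<iota> q'" using y(3) embed by simp
    then have "R \<theta> q = q'" using \<iota>(2) by (simp add: inj_eq)
    from F0_unique[OF q(1,3) this] show "y = y'" by (simp only: q(2,4))
  qed
  have F: "finite F" "F \<inter> Fix_S1 L = {}" using F0 free by (auto simp: F_def Kc_def)
  obtain m :: nat and \<psi> :: "'y \<Rightarrow> complex" where \<psi>: "1 \<le> m" "continuous_on UNIV \<psi>"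
    "\<forall>\<theta> y. \<psi> (L \<theta> y) = exp (\<i> * of_nat m * of_real \<theta>) * \<psi> y" "\<forall>y\<in>F. \<psi> y \<noteq> 0"
    using equivariant_function_on_finite_orbits[OF L F F_unique] by blast
  define K where "K = \<iota> ` Kc"
  have K_inv: "L \<theta> y \<in> K" if "y \<in> K" for \<theta> y using that Kc_inv by (auto simp: K_def embed[symmetric])
  have K_orbits: "K = (\<Union>y\<in>F. orbit_S1 L y)"
  proof (intro equalityI subsetI)
    fix y assume "y \<in> K"
    then obtain q where q: "q \<in> Kc" "y = \<iota> q" by (auto simp: K_def)
    have "q \<in> orbit_S1 R (rep (orbit_S1 R q))" using rep(2)[OF q(1)] orbit_S1_self[OF R] by metis
    then obtain \<theta> where "q = R \<theta> (rep (orbit_S1 R q))" by (auto simp: orbit_S1_def)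
    then have "y = L \<theta> (\<iota> (rep (orbit_S1 R q)))" using q(2) embed by metis
    then show "y \<in> (\<Union>y\<in>F. orbit_S1 L y)" using q(1) by (auto simp: F_def F0_def orbit_S1_def)
  next
    fix y assume "y \<in> (\<Union>y\<in>F. orbit_S1 L y)"
    then obtain q \<theta> where "q \<in> F0" "y = L \<theta> (\<iota> q)" by (auto simp: F_def orbit_S1_def)
    then show "y \<in> K" using F0(2) K_inv[of "\<iota> q"] by (auto simp: K_def)
  qed
  have "compact K"
    unfolding K_orbits using F0(1) by (intro compact_UN compact_orbit_S1[OF L]) (auto simp: F_def)
  moreover have "open {y. \<psi> y \<noteq> 0}" by (intro open_Collect_neq \<psi>(2) continuous_on_const)
  moreover have "K \<subseteq> {y. \<psi> y \<noteq> 0}"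
    using \<psi>(3,4) by (auto simp: K_orbits orbit_S1_def)
  ultimately obtain \<rho> where \<rho>: "0 < \<rho>" "(\<Union>y\<in>K. ball y \<rho>) \<subseteq> {y. \<psi> y \<noteq> 0}"
    by (rule compact_subset_open_imp_ball_epsilon_subset)
  have "K \<noteq> {}"
    using critical_set_nonempty[OF R C1 inv jk(1) levels(1) wPS] by (simp add: K_def Kc_def)
  define d where "d x = infdist (\<iota> x) K" for x
  have \<iota>_cont: "continuous_on UNIV \<iota>" using \<iota>(1) by (rule linear_continuous_on)
  have d_inv: "d (R \<theta> x) = d x" for \<theta> x
    unfolding d_def embed by (rule infdist_rep_invariant[OF L K_inv])
  have d_cont: "continuous_on UNIV d" unfolding d_def by (intro continuous_intros \<iota>_cont)
  have nz: "\<psi> (\<iota> x) \<noteq> 0" if "d x \<le> \<rho> / 2" for x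
  proof -
    have "(INF a\<in>K. dist (\<iota> x) a) < \<rho>"
      using that \<rho>(1) by (simp add: d_def infdist_notempty[OF \<open>K \<noteq> {}\<close>])
    moreover have "bdd_below (dist (\<iota> x) ` K)" by (rule bdd_belowI[of _ 0]) auto
    ultimately obtain a where "a \<in> K" "dist (\<iota> x) a < \<rho>"
      using cINF_less_iff[OF \<open>K \<noteq> {}\<close>, of "dist (\<iota> x)" \<rho>] by auto
    then have "\<iota> x \<in> (\<Union>y\<in>K. ball y \<rho>)" by (auto simp: dist_commute)
    with \<rho>(2) have "\<iota> x \<in> {y. \<psi> y \<noteq> 0}" by (rule subsetD)
    then show ?thesis by simp
  qed
  have near: "\<exists>B\<in>index_class R j. B \<subseteq> {x. \<rho> / 2 \<le> d x} \<and> (\<forall>x\<in>B. J x \<le> c + e)" if e: "0 < e" for e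
  proof -
    obtain A where A: "A \<in> index_class R k" "\<forall>x\<in>A. J x \<le> c + e"
      using minimax_near_optimal_set[OF levels(2) e] by (elim bexE)
    have "{x \<in> A. \<rho> / 2 \<le> d x} \<in> index_class R j"
    proof (rule index_class_excision[where d = d and \<psi> = "\<lambda>x. \<psi> (\<iota> x)" and m = m, OF R A(1) jk(2) d_cont d_inv])
      show "continuous_on UNIV (\<lambda>x. \<psi> (\<iota> x))"
        by (rule continuous_on_compose2[OF \<psi>(2) \<iota>_cont]) simp
      show "1 \<le> m" by (rule \<psi>(1))
      show "\<psi> (\<iota> (R \<theta> x)) = exp (\<i> * of_nat m * of_real \<theta>) * \<psi> (\<iota> x)" for \<theta> x
        using \<psi>(3) unfolding embed by blast
      show "\<psi> (\<iota> x) \<noteq> 0" if "d x \<le> \<rho> / 2" for x using that by (rule nz)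
    qed
    then show ?thesis using A(2) by (intro bexI[of _ "{x \<in> A. \<rho> / 2 \<le> d x}"]) auto
  qed
  obtain x z where xz: "\<forall>n. x n \<in> {x. \<rho> / 2 \<le> d x}" "(\<lambda>n. dist (x n) (z n)) \<longlonglongrightarrow> 0"
    "(\<lambda>n. J (z n)) \<longlonglongrightarrow> c" "(\<lambda>n. J' (z n)) \<longlonglongrightarrow> 0"
    using palais_smale_sequence_near[OF R C1 inv eq_refl[OF levels(1)[symmetric]] jk(1) near] by blast
  obtain r q where r: "strict_mono r" and lim: "(\<lambda>n. \<iota> (z (r n))) \<longlonglongrightarrow> \<iota> q" and q: "J q = c" "J' q = 0"
    using wPS xz(3,4) unfolding wPS_def by blast
  \<comment> \<open>the points z n are close to the points x n, and the latter keep the distance \<open>\<rho> / 2\<close> from K\<close>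
  have "(\<lambda>n. x n - z n) \<longlonglongrightarrow> 0"
    using xz(2) by (simp add: dist_norm tendsto_norm_zero_iff)
  then have "(\<lambda>n. \<iota> (x n - z n)) \<longlonglongrightarrow> \<iota> 0"
    by (rule bounded_linear.tendsto[OF \<iota>(1)])
  then have "(\<lambda>n. \<iota> (x n) - \<iota> (z n)) \<longlonglongrightarrow> 0"
    using \<iota>(1) by (simp add: bounded_linear.linear linear_diff linear_0)
  from LIMSEQ_subseq_LIMSEQ[OF this r]
  have "(\<lambda>n. (\<iota> (x (r n)) - \<iota> (z (r n))) + \<iota> (z (r n))) \<longlonglongrightarrow> 0 + \<iota> q"
    by (intro tendsto_add lim) (simp add: o_def)
  then have "(\<lambda>n. infdist (\<iota> (x (r n))) K) \<longlonglongrightarrow> infdist (\<iota> q) K"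
    by (intro tendsto_infdist) simp
  moreover have "\<rho> / 2 \<le> infdist (\<iota> (x (r n))) K" for n using xz(1) by (simp add: d_def)
  ultimately have "\<rho> / 2 \<le> infdist (\<iota> q) K" by (intro LIMSEQ_le_const) auto
  moreover have "\<iota> q \<in> K" using q by (auto simp: K_def Kc_def critical_set_def)
  ultimately show False using \<rho>(1) by simp
qed

theorem theorem2:
  fixes \<iota> :: "'x::{real_inner,complete_space} \<Rightarrow> 'y::banach"
    and L :: "real \<Rightarrow> 'y \<Rightarrow> 'y"
    and J :: "'x \<Rightarrow> real"
    and J' :: "'x \<Rightarrow> 'x \<Rightarrow>\<^sub>L real"
  assumes "inj \<iota>" and "compact_operator \<iota>"
    and "isometric_S1_rep L"
    and "\<And>\<theta>. L \<theta> ` range \<iota> = range \<iota>"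
    and "isometric_S1_rep (restrict_rep \<iota> L)"
    and "Fix_S1 L \<subseteq> range \<iota>"
    and "is_C1_with_derivative J J'"
    and "invariant_functional (restrict_rep \<iota> L) J"
  shows "(\<forall>j>0. - \<infinity> < minimax_level (restrict_rep \<iota> L) J j \<and>
            wPS \<iota> J J' (real_of_ereal (minimax_level (restrict_rep \<iota> L) J j)) \<longrightarrow>
            critical_set J J' (real_of_ereal (minimax_level (restrict_rep \<iota> L) J j)) \<noteq> {}) \<and>
         (\<forall>j k c. 0 < j \<and> j < k \<and>
            minimax_level (restrict_rep \<iota> L) J j = ereal c \<and> minimax_level (restrict_rep \<iota> L) J k = ereal c \<and>
            wPS \<iota> J J' c \<and>
            \<iota> ` critical_set J J' c \<inter> Fix_S1 L = {} \<longrightarrow>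
            (\<exists>q :: nat \<Rightarrow> 'x.
               (\<Union>n. orbit_S1 (restrict_rep \<iota> L) (q n)) \<subseteq> critical_set J J' c \<and>
               (\<forall>m n. m \<noteq> n \<longrightarrow> orbit_S1 (restrict_rep \<iota> L) (q m) \<inter> orbit_S1 (restrict_rep \<iota> L) (q n) = {})))"
proof (intro conjI allI impI; elim conjE)
  note R = assms(5) and C1 = assms(7) and inv = assms(8)
  fix j :: nat
  assume j: "0 < j" and finite_level: "- \<infinity> < minimax_level (restrict_rep \<iota> L) J j"
    and wPS: "wPS \<iota> J J' (real_of_ereal (minimax_level (restrict_rep \<iota> L) J j))"
  define c where "c = real_of_ereal (minimax_level (restrict_rep \<iota> L) J j)"
  have level: "minimax_level (restrict_rep \<iota> L) J j = ereal c"
    using finite_level minimax_level_less_infinity[OF R, of J j] by (auto simp: c_def ereal_real)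
  show "critical_set J J' (real_of_ereal (minimax_level (restrict_rep \<iota> L) J j)) \<noteq> {}"
    using critical_set_nonempty[OF R C1 inv j level] wPS by (simp add: c_def)
next
  note R = assms(5) and C1 = assms(7) and inv = assms(8)
  let ?R = "restrict_rep \<iota> L"
  fix j k :: nat and c :: real
  assume hyps: "0 < j" "j < k" "minimax_level ?R J j = ereal c" "minimax_level ?R J k = ereal c"
    "wPS \<iota> J J' c" "\<iota> ` critical_set J J' c \<inter> Fix_S1 L = {}"
  have "infinite (orbit_S1 ?R ` critical_set J J' c)"
    using infinitely_many_critical_orbits[OF _ assms(1,3) R restrict_rep_embed[OF assms(4)] C1 inv hyps]
      assms(2) by (simp add: compact_operator_def)
  then obtain orb :: "nat \<Rightarrow> 'x set" where orb: "inj orb" "range orb \<subseteq> orbit_S1 ?R ` critical_set J J' c"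
    using infinite_countable_subset by blast
  then have "\<forall>n. \<exists>q. q \<in> critical_set J J' c \<and> orb n = orbit_S1 ?R q" by blast
  then obtain q where q: "\<And>n. q n \<in> critical_set J J' c" "\<And>n. orb n = orbit_S1 ?R (q n)" by metis
  show "\<exists>q :: nat \<Rightarrow> 'x. (\<Union>n. orbit_S1 ?R (q n)) \<subseteq> critical_set J J' c \<and>
      (\<forall>m n. m \<noteq> n \<longrightarrow> orbit_S1 ?R (q m) \<inter> orbit_S1 ?R (q n) = {})"
  proof (intro exI[of _ q] conjI allI impI)
    show "(\<Union>n. orbit_S1 ?R (q n)) \<subseteq> critical_set J J' c"
      using critical_set_invariant[OF R C1 inv q(1)] by (auto simp: orbit_S1_def)
    fix m n :: nat assume "m \<noteq> n"
    then have "orbit_S1 ?R (q m) \<noteq> orbit_S1 ?R (q n)" using orb(1) q(2) by (metis injD)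
    then show "orbit_S1 ?R (q m) \<inter> orbit_S1 ?R (q n) = {}"
      using orbit_S1_eq[OF R] by (metis disjoint_iff)
  qed
qed

end
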